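(* Let $\mathcal{P}^+\subset\mathrm{Sym}^2(\mathbb{R}^n)$ be an elliptic cone and let $X\subset\mathbb{R}^n$ be a connected open set. Then each $\mathcal{P}^+$-plurisubharmonic distribution $u$ on $X$ is $L^1_{\rm loc}$-upper-semi-continuous. That is, $u\in L^1_{\rm loc}(X)$, and the essential limit superior $\widetilde u(x)=\mathrm{ess}\limsup_{y\to x}u(y)$ satisfies: (i) $\widetilde u\in\mathrm{USC}(X)$, and (ii) $\widetilde u$ lies in the $L^1_{\rm loc}(X)$-equivalence class of $u$.
   Context: $\mathrm{Sym}^2(\mathbb{R}^n)$ is the space of real symmetric $n\times n$ matrices with inner product $\langle A,B\rangle=\mathrm{tr}(AB)$. For a closed convex cone $\mathcal{P}^+\subset\mathrm{Sym}^2(\mathbb{R}^n)$ with vertex at the origin, its polar is $\mathcal{P}_+=\{A:\langle A,B\rangle\ge0\ \forall B\in\mathcal{P}^+\}$, and $\mathrm{Int}\,\mathcal{P}_+$ is the interior of $\mathcal{P}_+$ relative to its linear span. $\mathcal{P}^+$ is an elliptic cone if every $A\in\mathrm{Int}\,\mathcal{P}_+$ is positive definite. A distribution $u\in\mathcal{D}'(X)$ is $\mathcal{P}^+$-plurisubharmonic if $(\mathrm{Hess}\,u)(\varphi A)\ge0$ for all $A\in\mathcal{P}_+$ and all $\varphi\in C^\infty_{\rm cpt}(X)$ with $\varphi\ge0$; equivalently $\langle\mathrm{Hess}\,u,A\rangle$ is a non-negative measure for each $A\in\mathcal{P}_+$. $\mathrm{USC}(X)$ is the space of upper semi-continuous functions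 $X\to[-\infty,\infty)$ which are not $\equiv-\infty$ on any component of $X$. *)

theory Defs
  imports "HOL-Analysis.Analysis" "HOL-Probability.Essential_Supremum"
begin

definition Sym2 :: "(real^'n^'n) set" where
  "Sym2 = {A. transpose A = A}"

definition positive_definite :: "real^'n^'n \<Rightarrow> bool" where
  "positive_definite A \<longleftrightarrow> A \<in> Sym2 \<and> (\<forall>v. v \<noteq> 0 \<longrightarrow> v \<bullet> (A *v v) > 0)"

definition polar_cone :: "(real^'n^'n) set \<Rightarrow> (real^'n^'n) set" where
  "polar_cone P = {A \<in> Sym2. \<forall>B\<in>P. trace (A ** B) \<ge> 0}"

definition Int_polar :: "(real^'n^'n) set \<Rightarrow> (real^'n^'n) set" where
  "Int_polar P = top_of_set (span (polar_cone P)) interior_of polar_cone P"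

definition elliptic_cone :: "(real^'n^'n) set \<Rightarrow> bool" where
  "elliptic_cone P \<longleftrightarrow>
     P \<subseteq> Sym2 \<and> closed P \<and> convex_cone P \<and> (\<forall>A\<in>Int_polar P. positive_definite A)"

definition pderiv_dir :: "'n \<Rightarrow> (real^'n \<Rightarrow> real) \<Rightarrow> real^'n \<Rightarrow> real" where
  "pderiv_dir i f = (\<lambda>x. frechet_derivative f (at x) (axis i 1))"

primrec C_k :: "nat \<Rightarrow> (real^'n \<Rightarrow> real) \<Rightarrow> bool" where
  "C_k 0 f \<longleftrightarrow> continuous_on UNIV f"
| "C_k (Suc k) f \<longleftrightarrow> f differentiable_on UNIV \<and> (\<forall>i. C_k k (pderiv_dir i f))"

text \<open>Test functions on an open set are represented by their extension by zero to the whole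
  space. The same set, for a compact \<open>K\<close>, consists of the smooth functions supported in \<open>K\<close>.\<close>

definition test_functions :: "(real^'n) set \<Rightarrow> (real^'n \<Rightarrow> real) set" where
  "test_functions X =
     {\<phi>. (\<forall>k. C_k k \<phi>) \<and> compact (closure {x. \<phi> x \<noteq> 0}) \<and> closure {x. \<phi> x \<noteq> 0} \<subseteq> X}"

text \<open>Continuity is expressed by seminorm estimates on each compact subset. Multi-indices are
  represented by lists of directions; the values of \<open>u\<close> outside the test functions on \<open>X\<close> are
  irrelevant.\<close>

definition distribution_on :: "(real^'n) set \<Rightarrow> ((real^'n \<Rightarrow> real) \<Rightarrow> real) \<Rightarrow> bool" where
  "distribution_on X u \<longleftrightarrow>
     (\<forall>\<phi>\<in>test_functions X. \<forall>\<psi>\<in>test_functions X. \<forall>a b.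
        u (\<lambda>x. a * \<phi> x + b * \<psi> x) = a * u \<phi> + b * u \<psi>) \<and>
     (\<forall>K. compact K \<and> K \<subseteq> X \<longrightarrow>
        (\<exists>C N. \<forall>\<phi>\<in>test_functions K.
           \<bar>u \<phi>\<bar> \<le> C * (\<Sum>is\<in>{is. length is \<le> N}. SUP x. \<bar>foldr pderiv_dir is \<phi> x\<bar>)))"

definition dist_pderiv ::
    "'n \<Rightarrow> ((real^'n \<Rightarrow> real) \<Rightarrow> real) \<Rightarrow> ((real^'n \<Rightarrow> real) \<Rightarrow> real)" where
  "dist_pderiv i u = (\<lambda>\<phi>. - u (pderiv_dir i \<phi>))"

text \<open>The matrix-valued distribution \<open>Hess u\<close>, paired with matrix-valued test functions
  through the trace inner product.\<close>

definition Hess :: "((real^'n \<Rightarrow> real) \<Rightarrow> real) \<Rightarrow> (real^'n \<Rightarrow> real^'n^'n) \<Rightarrow> real" where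
  "Hess u \<Phi> = (\<Sum>i\<in>UNIV. \<Sum>j\<in>UNIV. dist_pderiv i (dist_pderiv j u) (\<lambda>x. \<Phi> x $ i $ j))"

definition plurisubharmonic_dist ::
    "(real^'n^'n) set \<Rightarrow> (real^'n) set \<Rightarrow> ((real^'n \<Rightarrow> real) \<Rightarrow> real) \<Rightarrow> bool" where
  "plurisubharmonic_dist P X u \<longleftrightarrow> distribution_on X u \<and>
     (\<forall>A\<in>polar_cone P. \<forall>\<phi>\<in>test_functions X.
        (\<forall>x. \<phi> x \<ge> 0) \<longrightarrow> Hess u (\<lambda>x. \<phi> x *\<^sub>R A) \<ge> 0)"

definition L1_loc :: "(real^'n) set \<Rightarrow> (real^'n \<Rightarrow> real) set" where
  "L1_loc X = {f. \<forall>K. compact K \<and> K \<subseteq> X \<longrightarrow> f absolutely_integrable_on K}"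

definition represents ::
    "(real^'n) set \<Rightarrow> (real^'n \<Rightarrow> real) \<Rightarrow> ((real^'n \<Rightarrow> real) \<Rightarrow> real) \<Rightarrow> bool" where
  "represents X f u \<longleftrightarrow> f \<in> L1_loc X \<and>
     (\<forall>\<phi>\<in>test_functions X. u \<phi> = (LINT x|lebesgue_on X. f x * \<phi> x))"

text \<open>The essential suprema decrease as the radius tends to \<open>0\<close>, so their limit is the infimum.\<close>

definition ess_limsup :: "(real^'n) set \<Rightarrow> (real^'n \<Rightarrow> ereal) \<Rightarrow> real^'n \<Rightarrow> ereal" where
  "ess_limsup X f x = (INF r\<in>{0<..}. esssup (lebesgue_on (X \<inter> ball x r)) f)"

definition USC :: "(real^'n) set \<Rightarrow> (real^'n \<Rightarrow> ereal) set" where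
  "USC X = {f. (\<forall>x\<in>X. f x < \<infinity>) \<and>
               (\<forall>a. openin (top_of_set X) {x \<in> X. f x < a}) \<and>
               (\<forall>C\<in>components X. \<exists>x\<in>C. f x \<noteq> -\<infinity>)}"

end

theory Submission
  imports Defs
begin

text \<open>
  The relative interior of the polar cone is not empty, so the polar of an elliptic cone contains a positive
  definite matrix \<open>A\<close>, and \<open>u\<close> is a subsolution of the operator \<open>L = \<Sum>i j. A $ i $ j * \<partial>\<^sub>i \<partial>\<^sub>j\<close>: the number
  \<open>u (L \<phi>)\<close> is non-negative for every non-negative test function \<open>\<phi>\<close>. In coordinates adapted to \<open>A\<close> the claim is the classical one that a
  distribution with \<open>\<Delta> u \<ge> 0\<close> is given by a subharmonic function. The proof stays in the original
  coordinates and replaces balls by the ellipsoids of the quadratic form \<open>q x = x \<bullet> (B *v x)\<close>, \<open>B\<close> the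
  inverse of \<open>A\<close>.

  The central point is a family of mollifiers along which \<open>u\<close> is monotone, not merely
  approximated. Let \<open>G\<close> be a smooth bump that is a decreasing function of \<open>q\<close>, with gradient
  \<open>- H x *\<^sub>R (B *v x)\<close>. Then \<open>H\<close> is again a bump, the field \<open>A *v \<nabla> G\<close> is \<open>- H x *\<^sub>R x\<close>, and
  therefore \<open>L G = - (n * H + x \<bullet> \<nabla> H)\<close>. Up to sign and a power of the scale, the right-hand
  side is the derivative with respect to \<open>s\<close> of the dilated kernel \<open>s ^ n * H (s *\<^sub>R x)\<close>. The difference of
  the kernels of two scales is thus \<open>L \<psi>\<close> with \<open>\<psi> \<ge> 0\<close>, a superposition of copies of \<open>G\<close>
  (\<open>kernel_diff\<close>), and the regularisations \<open>V s y\<close>, obtained by applying \<open>u\<close> to the kernel centred at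
  \<open>y\<close>, decrease as \<open>s\<close> grows (\<open>V_antimono\<close>). They are continuous in \<open>y\<close>, so their infimum \<open>W\<close>, divided by
  the mass of \<open>H\<close>, is an upper semicontinuous function with values in \<open>[-\<infinity>, \<infinity>)\<close>.

  That \<open>W\<close> is locally integrable and represents \<open>u\<close> comes from monotone convergence:
  \<open>\<integral> \<phi> * V s\<close> is \<open>u\<close> applied to a convolution, hence tends to the mass times \<open>u \<phi>\<close>
  (\<open>pairing_V\<close>, \<open>pairing_limit\<close>); as these limits are finite, \<open>W\<close> is finite almost everywhere and
  \<open>\<integral> W * \<phi> = u \<phi>\<close> (\<open>pairing_w_nonneg\<close>). Exchanging \<open>u\<close> with an integral over a parameter is
  justified by Riemann sums, which converge together with all derivatives
  (\<open>distribution_superposition\<close>).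

  Any other representative \<open>f\<close> agrees with \<open>W\<close> almost everywhere by the fundamental lemma of the calculus
  of variations. At every point the essential limit superior of \<open>f\<close> is \<open>W\<close>: it is at most \<open>W x\<close> because \<open>W\<close>
  is upper semicontinuous, and at least \<open>W x\<close> because \<open>W x\<close> lies below every mean of \<open>f\<close> over
  a small ellipsoid around \<open>x\<close> (\<open>ess_limsup_eq_W\<close>).
\<close>

section \<open>Calculus of smooth functions\<close>

definition smooth :: "(real^'n \<Rightarrow> real) \<Rightarrow> bool" where
  "smooth f \<longleftrightarrow> (\<forall>k. C_k k f)"

lemma pderiv_dir_eqI:
  assumes "(f has_derivative f') (at x)"
  shows "pderiv_dir i f x = f' (axis i 1)"
  using assms by (metis frechet_derivative_at pderiv_dir_def)

lemma C_k_Suc_imp: "C_k (Suc k) f \<Longrightarrow> C_k k f"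
proof (induction k arbitrary: f)
  case 0
  then show ?case by (auto simp: differentiable_imp_continuous_on)
next
  case (Suc k)
  then show ?case by (metis C_k.simps(2))
qed

lemma C_k_const: "C_k k (\<lambda>x. c)"
proof (induction k arbitrary: c)
  case (Suc k)
  have "pderiv_dir i (\<lambda>x. c) = (\<lambda>x. 0)" for i :: 'a
    by (rule ext, subst pderiv_dir_eqI[OF has_derivative_const]) simp
  then show ?case using Suc by simp
qed simp

lemma differentiable_on_UNIV_has_derivative:
  "f differentiable_on UNIV \<Longrightarrow> (f has_derivative frechet_derivative f (at x)) (at x)"
  by (simp add: differentiable_on_def frechet_derivative_works)

lemma pderiv_dir_lincomb:
  assumes "f differentiable_on UNIV" "g differentiable_on UNIV"
  shows "pderiv_dir i (\<lambda>x. a * f x + b * g x) = (\<lambda>x. a * pderiv_dir i f x + b * pderiv_dir i g x)"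
  by (rule ext, subst pderiv_dir_eqI)
    (auto intro!: derivative_eq_intros differentiable_on_UNIV_has_derivative assms
       simp: pderiv_dir_def)

lemma pderiv_dir_mult:
  assumes "f differentiable_on UNIV" "g differentiable_on UNIV"
  shows "pderiv_dir i (\<lambda>x. f x * g x) = (\<lambda>x. f x * pderiv_dir i g x + pderiv_dir i f x * g x)"
  by (rule ext, subst pderiv_dir_eqI)
    (auto intro!: derivative_eq_intros differentiable_on_UNIV_has_derivative assms
       simp: pderiv_dir_def)

lemma pderiv_dir_compose:
  assumes "r differentiable_on UNIV" and "\<And>t. (h has_real_derivative h' t) (at t)"
  shows "pderiv_dir i (\<lambda>x. h (r x)) = (\<lambda>x. h' (r x) * pderiv_dir i r x)"
proof
  fix x
  have "((\<lambda>x. h (r x)) has_derivative (\<lambda>v. h' (r x) * frechet_derivative r (at x) v)) (at x)"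
    using has_derivative_compose[OF differentiable_on_UNIV_has_derivative[OF assms(1)],
        of h "(*) (h' (r x))" x] assms(2)[of "r x"]
    by (simp add: has_field_derivative_def)
  then show "pderiv_dir i (\<lambda>x. h (r x)) x = h' (r x) * pderiv_dir i r x"
    by (subst pderiv_dir_eqI) (auto simp: pderiv_dir_def)
qed

lemma C_k_lincomb: "C_k k f \<Longrightarrow> C_k k g \<Longrightarrow> C_k k (\<lambda>x. a * f x + b * g x)"
proof (induction k arbitrary: f g)
  case (Suc k)
  then show ?case
    by (auto simp: pderiv_dir_lincomb intro!: derivative_intros)
qed (auto intro!: continuous_intros)

lemma C_k_mult: "C_k k f \<Longrightarrow> C_k k g \<Longrightarrow> C_k k (\<lambda>x. f x * g x)"
proof (induction k arbitrary: f g)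
  case (Suc k)
  have "C_k k f" "C_k k g" using Suc.prems by (auto dest: C_k_Suc_imp simp del: C_k.simps)
  then have "C_k k (\<lambda>x. 1 * (f x * pderiv_dir i g x) + 1 * (pderiv_dir i f x * g x))" for i
    using Suc by (intro C_k_lincomb Suc.IH) auto
  then show ?case using Suc.prems
    by (auto simp: pderiv_dir_mult intro!: derivative_intros)
qed (auto intro!: continuous_intros)

lemma smooth_const: "smooth (\<lambda>x. c)"
  and smooth_lincomb: "smooth f \<Longrightarrow> smooth g \<Longrightarrow> smooth (\<lambda>x. a * f x + b * g x)"
  and smooth_mult: "smooth f \<Longrightarrow> smooth g \<Longrightarrow> smooth (\<lambda>x. f x * g x)"
  by (auto simp: smooth_def C_k_const C_k_lincomb C_k_mult)

lemma smooth_add: "smooth f \<Longrightarrow> smooth g \<Longrightarrow> smooth (\<lambda>x. f x + g x)"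
  using smooth_lincomb[of f g 1 1] by simp

lemma smooth_diff: "smooth f \<Longrightarrow> smooth g \<Longrightarrow> smooth (\<lambda>x. f x - g x)"
  using smooth_lincomb[of f g 1 "-1"] by simp

lemma smooth_sum: "(\<And>i. i \<in> I \<Longrightarrow> smooth (f i)) \<Longrightarrow> smooth (\<lambda>x. \<Sum>i\<in>I. f i x)"
  by (induction I rule: infinite_finite_induct) (auto intro: smooth_const smooth_add)

lemma smooth_differentiable: "smooth f \<Longrightarrow> f differentiable_on UNIV"
  unfolding smooth_def by (metis C_k.simps(2))

lemma smooth_continuous: "smooth f \<Longrightarrow> continuous_on S f"
  by (meson continuous_on_subset differentiable_imp_continuous_on smooth_differentiable subset_UNIV)

lemma smooth_pderiv: "smooth f \<Longrightarrow> smooth (pderiv_dir i f)"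
  unfolding smooth_def by (metis C_k.simps(2))

lemma smooth_foldr_pderiv: "smooth f \<Longrightarrow> smooth (foldr pderiv_dir is f)"
  by (induction "is") (auto intro: smooth_pderiv)

lemma foldr_pderiv_lincomb:
  assumes "smooth f" "smooth g"
  shows "foldr pderiv_dir is (\<lambda>x. a * f x + b * g x)
    = (\<lambda>x. a * foldr pderiv_dir is f x + b * foldr pderiv_dir is g x)"
  by (induction "is")
    (simp_all add: pderiv_dir_lincomb smooth_foldr_pderiv smooth_differentiable assms)

text \<open>Smoothness of dilated translates and of parameter integrals is shown by this principle: a partial
  derivative of such a function has the same form, with another coefficient and another profile.\<close>

lemma smooth_coinduct:
  assumes "f \<in> S" and "\<And>g. g \<in> S \<Longrightarrow> g differentiable_on UNIV"
    and "\<And>g i. g \<in> S \<Longrightarrow> pderiv_dir i g \<in> S"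
  shows "smooth f"
proof -
  have "C_k k g" if "g \<in> S" for k g
    using that by (induction k arbitrary: g) (use assms in \<open>auto simp: differentiable_imp_continuous_on\<close>)
  then show ?thesis using assms(1) by (simp add: smooth_def)
qed

lemma smooth_bounded_linear:
  assumes "bounded_linear f" shows "smooth f"
proof -
  have d: "(f has_derivative f) (at x)" for x
    using assms bounded_linear_imp_has_derivative by blast
  have "pderiv_dir i f = (\<lambda>x. f (axis i 1))" for i
    by (rule ext, rule pderiv_dir_eqI[OF d])
  moreover have "f differentiable_on UNIV"
    using d by (auto simp: differentiable_on_def differentiable_def)
  ultimately have "C_k (Suc k) f" for k by (simp add: C_k_const)
  then show ?thesis unfolding smooth_def using C_k_Suc_imp by blast
qed

section \<open>Flat functions\<close>

text \<open>The derivatives of \<open>exp (- 1 / t)\<close> are combinations of the functions \<open>exp (- 1 / t) / t ^ k\<close>, so the whole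
  family, extended by \<open>0\<close>, is closed under differentiation. All bumps and cutoffs are built from it.\<close>

definition flat :: "nat \<Rightarrow> real \<Rightarrow> real" where
  "flat k t = (if t > 0 then exp (- 1 / t) / t ^ k else 0)"

lemma flat_nonneg: "flat k t \<ge> 0"
  by (simp add: flat_def)

lemma flat_pos_iff: "flat k t > 0 \<longleftrightarrow> t > 0"
  by (simp add: flat_def)

text \<open>Only the origin needs an argument: there the difference quotient from the right is a power of \<open>1 / h\<close>
  divided by \<open>exp (1 / h)\<close>.\<close>

lemma flat_DERIV: "(flat k has_real_derivative (flat (k + 2) t - k * flat (k + 1) t)) (at t)"
proof -
  consider "t > 0" | "t < 0" | "t = 0" by linarith
  then show ?thesis
  proof cases
    case 1
    have "((\<lambda>t. exp (- 1 / t) / t ^ k) has_real_derivative (flat (k + 2) t - k * flat (k + 1) t)) (at t)"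
      using 1 apply (auto intro!: derivative_eq_intros simp: flat_def)
      apply (cases k)
       apply (auto simp: field_simps power2_eq_square)
      done
    moreover have "\<forall>\<^sub>F s in nhds t. exp (- 1 / s) / s ^ k = flat k s"
      using eventually_nhds_in_open[of "{0<..}" t] 1
      by (auto elim!: eventually_mono simp: flat_def)
    ultimately show ?thesis
      using DERIV_cong_ev[OF refl _ refl] by metis
  next
    case 2
    have "\<forall>\<^sub>F s in nhds t. 0 = flat k s"
      using eventually_nhds_in_open[of "{..<0}" t] 2
      by (auto elim!: eventually_mono simp: flat_def)
    then have "((\<lambda>s. 0) has_real_derivative 0) (at t) = (flat k has_real_derivative 0) (at t)"
      by (intro DERIV_cong_ev refl)
    then show ?thesis using 2 by (simp add: flat_def)
  next
    case 3
    have "((\<lambda>h. flat k h / h) \<longlongrightarrow> 0) (at_left 0)"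
      by (rule tendsto_eventually) (auto simp: eventually_at_filter flat_def)
    moreover have "((\<lambda>h. flat k h / h) \<longlongrightarrow> 0) (at_right 0)"
    proof (rule Lim_transform_eventually)
      have "((\<lambda>h. inverse h ^ Suc k / exp (inverse h)) \<longlongrightarrow> 0) (at_right (0::real))"
        by (rule filterlim_compose[OF tendsto_power_div_exp_0 filterlim_inverse_at_top_right])
      then show "((\<lambda>h. exp (- 1 / h) / h ^ k / h) \<longlongrightarrow> 0) (at_right (0::real))"
        by (simp add: field_simps exp_minus)
      show "\<forall>\<^sub>F h in at_right 0. exp (- 1 / h) / h ^ k / h = flat k h / h"
        by (auto simp: eventually_at_filter flat_def)
    qed
    ultimately have "((\<lambda>h. flat k h / h) \<longlongrightarrow> 0) (at 0)"
      by (simp add: filterlim_split_at)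
    then show ?thesis using 3 by (simp add: DERIV_def flat_def)
  qed
qed

lemma smooth_flat_compose:
  assumes "smooth r" shows "smooth (\<lambda>x. flat k (r x))"
proof -
  have d: "(\<lambda>x. flat k (r x)) differentiable_on UNIV" for k
    unfolding differentiable_on_def
  proof
    fix x
    have "(flat k has_derivative (*) (flat (k + 2) (r x) - k * flat (k + 1) (r x))) (at (r x))"
      using flat_DERIV[of k "r x"] by (simp add: has_field_derivative_def)
    then show "(\<lambda>x. flat k (r x)) differentiable at x"
      using has_derivative_compose differentiable_on_UNIV_has_derivative smooth_differentiable[OF assms]
      unfolding differentiable_def by blast
  qed
  have "C_k j (\<lambda>x. flat k (r x))" for j
  proof (induction j arbitrary: k)
    case (Suc j)
    have "C_k j (\<lambda>x. (1 * flat (k + 2) (r x) + (- real k) * flat (k + 1) (r x)) * pderiv_dir i r x)" for i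
      using Suc assms smooth_pderiv[OF assms] unfolding smooth_def by (intro C_k_mult C_k_lincomb) auto
    then show ?case
      using d pderiv_dir_compose[OF smooth_differentiable[OF assms] flat_DERIV, of _ k] by simp
  qed (use d differentiable_imp_continuous_on in auto)
  then show ?thesis by (simp add: smooth_def)
qed

lemma flat_0_le_1: "flat 0 t \<le> 1"
  by (simp add: flat_def)

section \<open>Test functions\<close>

lemma test_functionsD:
  assumes "\<phi> \<in> test_functions X"
  shows "smooth \<phi>" "compact (closure {x. \<phi> x \<noteq> 0})" "closure {x. \<phi> x \<noteq> 0} \<subseteq> X"
  using assms by (auto simp: test_functions_def smooth_def)

lemma test_functionsI:
  assumes "smooth \<phi>" "compact K" "K \<subseteq> X" "\<And>x. x \<notin> K \<Longrightarrow> \<phi> x = 0"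
  shows "\<phi> \<in> test_functions X"
proof -
  have "closure {x. \<phi> x \<noteq> 0} \<subseteq> K"
    using assms by (intro closure_minimal) (auto simp: compact_imp_closed)
  moreover from this have "compact (closure {x. \<phi> x \<noteq> 0})"
    by (metis assms(2) closed_closure compact_Int_closed inf.absorb_iff2)
  ultimately show ?thesis
    using assms unfolding test_functions_def smooth_def by auto
qed

lemma test_functions_eq_0: "\<phi> \<in> test_functions X \<Longrightarrow> x \<notin> X \<Longrightarrow> \<phi> x = 0"
  using test_functionsD(3)[of \<phi> X] closure_subset[of "{x. \<phi> x \<noteq> 0}"] by blast

lemma test_functions_mono: "\<phi> \<in> test_functions X \<Longrightarrow> X \<subseteq> Y \<Longrightarrow> \<phi> \<in> test_functions Y"
  by (auto simp: test_functions_def)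

lemma test_functions_lincomb:
  assumes "\<phi> \<in> test_functions X" "\<psi> \<in> test_functions X"
  shows "(\<lambda>x. a * \<phi> x + b * \<psi> x) \<in> test_functions X"
proof (rule test_functionsI[of _ "closure {x. \<phi> x \<noteq> 0} \<union> closure {x. \<psi> x \<noteq> 0}"])
  show "a * \<phi> x + b * \<psi> x = 0"
    if "x \<notin> closure {x. \<phi> x \<noteq> 0} \<union> closure {x. \<psi> x \<noteq> 0}" for x
    using that closure_subset[of "{x. \<phi> x \<noteq> 0}"] closure_subset[of "{x. \<psi> x \<noteq> 0}"]
    by (metis (mono_tags, lifting) UnCI add.right_neutral mem_Collect_eq mult_zero_right subsetD)
qed (use test_functionsD[OF assms(1)] test_functionsD[OF assms(2)] in \<open>auto intro: smooth_lincomb\<close>)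

lemma test_functions_0: "(\<lambda>x. 0) \<in> test_functions X"
  by (rule test_functionsI[of _ "{}"]) (auto intro: smooth_const)

lemma test_functions_sum:
  assumes "\<And>i. i \<in> I \<Longrightarrow> \<phi> i \<in> test_functions X"
  shows "(\<lambda>x. \<Sum>i\<in>I. c i * \<phi> i x) \<in> test_functions X"
  using assms
proof (induction I rule: infinite_finite_induct)
  case (insert i I)
  then show ?case using test_functions_lincomb[of "\<phi> i" X "\<lambda>x. \<Sum>i\<in>I. c i * \<phi> i x" "c i" 1] by simp
qed (auto intro: test_functions_0)

lemma pderiv_dir_eq_0:
  assumes "x \<notin> closure {x. \<phi> x \<noteq> 0}"
  shows "pderiv_dir i \<phi> x = 0"
proof -
  have "\<phi> y = 0" if "y \<in> - closure {x. \<phi> x \<noteq> 0}" for y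
    using that closure_subset[of "{x. \<phi> x \<noteq> 0}"] by auto
  note zero = this
  have "(\<phi> has_derivative (\<lambda>x. 0)) (at x)"
  proof (rule has_derivative_transform_within_open)
    show "((\<lambda>x. 0) has_derivative (\<lambda>x. 0)) (at x)" by simp
    show "open (- closure {x. \<phi> x \<noteq> 0})" by (rule open_Compl) (rule closed_closure)
    show "x \<in> - closure {x. \<phi> x \<noteq> 0}" using assms by (rule Compl_iff[THEN iffD2])
  qed (erule zero[symmetric])
  from pderiv_dir_eqI[OF this] show ?thesis .
qed

lemma test_functions_pderiv:
  assumes "\<phi> \<in> test_functions X" shows "pderiv_dir i \<phi> \<in> test_functions X"
  by (rule test_functionsI[OF smooth_pderiv[OF test_functionsD(1)[OF assms]]
        test_functionsD(2,3)[OF assms] pderiv_dir_eq_0])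

lemma foldr_pderiv_sum:
  assumes "\<And>i. i \<in> I \<Longrightarrow> smooth (f i)"
  shows "foldr pderiv_dir is (\<lambda>x. \<Sum>i\<in>I. c i * f i x) = (\<lambda>x. \<Sum>i\<in>I. c i * foldr pderiv_dir is (f i) x)"
proof -
  have zero: "foldr pderiv_dir is (\<lambda>x. 0 :: real) = (\<lambda>x. 0)"
    using foldr_pderiv_lincomb[of "\<lambda>x. 0" "\<lambda>x. 0" "is" 0 0] by (simp add: smooth_const)
  show ?thesis using assms
  proof (induction I rule: infinite_finite_induct)
    case (insert i I)
    have "smooth (\<lambda>x. \<Sum>i\<in>I. c i * f i x)"
      using insert.prems by (intro smooth_sum smooth_mult smooth_const) auto
    then show ?case
      using insert foldr_pderiv_lincomb[of "f i" "\<lambda>x. \<Sum>i\<in>I. c i * f i x" "is" "c i" 1] by simp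
  qed (auto simp: zero)
qed

lemma eq_0_outside_closure: "x \<notin> closure {x. \<phi> x \<noteq> 0} \<Longrightarrow> \<phi> x = 0"
  using closure_subset[of "{x. \<phi> x \<noteq> 0}"] by blast

text \<open>The compact set is the union of the closed balls. It contains the supports of all test functions that
  arise from one supported in \<open>S\<close> by moving or averaging it over distances up to \<open>e\<close>.\<close>

lemma thickening:
  fixes S X :: "(real^'n) set"
  assumes "compact S" "(\<Union>x\<in>S. cball x e) \<subseteq> X"
  obtains K where "compact K" "K \<subseteq> X" "\<And>x y. y \<in> S \<Longrightarrow> norm (x - y) \<le> e \<Longrightarrow> x \<in> K"
proof (rule that)
  have "(\<Union>x\<in>S. cball x e) = {x + z |x z. x \<in> S \<and> z \<in> cball 0 e}"
  proof (intro equalityI subsetI)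
    fix w assume "w \<in> (\<Union>x\<in>S. cball x e)"
    then obtain x where "x \<in> S" "norm (w - x) \<le> e" by (auto simp: dist_norm norm_minus_commute)
    then show "w \<in> {x + z |x z. x \<in> S \<and> z \<in> cball 0 e}"
      by (intro CollectI exI[of _ x] exI[of _ "w - x"]) auto
  next
    fix w assume "w \<in> {x + z |x z. x \<in> S \<and> z \<in> cball 0 e}"
    then obtain x z where "w = x + z" "x \<in> S" "norm z \<le> e" by auto
    then show "w \<in> (\<Union>x\<in>S. cball x e)"
      by (intro UN_I[of x]) (auto simp: dist_norm)
  qed
  then show "compact (\<Union>x\<in>S. cball x e)"
    using compact_sums[OF assms(1) compact_cball[of 0 e]] by simp
qed (use assms(2) in \<open>auto simp: dist_norm norm_minus_commute\<close>)

section \<open>Distributions\<close>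

lemma distribution_lincomb:
  assumes "distribution_on X u" "\<phi> \<in> test_functions X" "\<psi> \<in> test_functions X"
  shows "u (\<lambda>x. a * \<phi> x + b * \<psi> x) = a * u \<phi> + b * u \<psi>"
  using assms unfolding distribution_on_def by blast

lemma distribution_diff:
  assumes "distribution_on X u" "\<phi> \<in> test_functions X" "\<psi> \<in> test_functions X"
  shows "u (\<lambda>x. \<phi> x - \<psi> x) = u \<phi> - u \<psi>"
  using distribution_lincomb[OF assms, of 1 "-1"] by simp

lemma distribution_0: "distribution_on X u \<Longrightarrow> u (\<lambda>x. 0) = 0"
  using distribution_lincomb[OF _ test_functions_0 test_functions_0, of X u 0 0] by simp

lemma distribution_cmult:
  assumes "distribution_on X u" "\<phi> \<in> test_functions X"
  shows "u (\<lambda>x. c * \<phi> x) = c * u \<phi>"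
  using distribution_lincomb[OF assms test_functions_0, of c 0] by simp

lemma distribution_sum:
  assumes "distribution_on X u" "\<And>i. i \<in> I \<Longrightarrow> \<phi> i \<in> test_functions X"
  shows "u (\<lambda>x. \<Sum>i\<in>I. c i * \<phi> i x) = (\<Sum>i\<in>I. c i * u (\<phi> i))"
  using assms(2)
proof (induction I rule: infinite_finite_induct)
  case (insert i I)
  have "(\<lambda>x. \<Sum>i\<in>I. c i * \<phi> i x) \<in> test_functions X" "\<phi> i \<in> test_functions X"
    using insert.prems by (auto intro: test_functions_sum)
  note distribution_lincomb[OF assms(1) this(2) this(1), of "c i" 1]
  moreover have "u (\<lambda>x. \<Sum>i\<in>I. c i * \<phi> i x) = (\<Sum>i\<in>I. c i * u (\<phi> i))"
    using insert by simp
  ultimately show ?case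
    using insert.hyps by simp
qed (auto simp: distribution_0[OF assms(1)])

text \<open>The continuity estimate with the sum of suprema replaced by one common bound \<open>e\<close> for all derivatives up to
  order \<open>N\<close>; there are finitely many of these, so their number is absorbed in the constant.\<close>

lemma distribution_bound:
  assumes "distribution_on X u" "compact K" "K \<subseteq> X"
  obtains M N where "M \<ge> 0" and
    "\<And>\<phi> e. \<lbrakk>\<phi> \<in> test_functions K; \<And>is x. length is \<le> N \<Longrightarrow> \<bar>foldr pderiv_dir is \<phi> x\<bar> \<le> e\<rbrakk>
      \<Longrightarrow> \<bar>u \<phi>\<bar> \<le> M * e"
proof -
  have "\<exists>C N. \<forall>\<phi>\<in>test_functions K.
      \<bar>u \<phi>\<bar> \<le> C * (\<Sum>is\<in>{is. length is \<le> N}. SUP x. \<bar>foldr pderiv_dir is \<phi> x\<bar>)"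
    by (rule assms(1)[unfolded distribution_on_def, THEN conjunct2, rule_format])
      (intro conjI assms)
  then obtain C N where CN: "\<And>\<phi>. \<phi> \<in> test_functions K \<Longrightarrow>
    \<bar>u \<phi>\<bar> \<le> C * (\<Sum>is\<in>{is. length is \<le> N}. SUP x. \<bar>foldr pderiv_dir is \<phi> x\<bar>)"
    by (elim exE) (rule that, erule bspec)
  define I :: "'a list set" where "I = {is. length is \<le> N}"
  show thesis
  proof (rule that[of "\<bar>C\<bar> * card I" N])
    fix \<phi> e assume \<phi>: "\<phi> \<in> test_functions K"
      and e: "\<And>is x. length is \<le> N \<Longrightarrow> \<bar>foldr pderiv_dir is \<phi> x\<bar> \<le> e"
    have *: "(SUP x. \<bar>foldr pderiv_dir is \<phi> x\<bar>) \<in> {0..e}" if "is \<in> I" for "is"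
    proof -
      have b: "bdd_above (range (\<lambda>x. \<bar>foldr pderiv_dir is \<phi> x\<bar>))"
        using e that by (auto simp: I_def bdd_above_def)
      have "0 \<le> \<bar>foldr pderiv_dir is \<phi> 0\<bar>" by simp
      also have "\<dots> \<le> (SUP x. \<bar>foldr pderiv_dir is \<phi> x\<bar>)"
        by (rule cSUP_upper[OF _ b]) simp
      finally show ?thesis
        using e that by (auto simp: I_def intro!: cSUP_least)
    qed
    have "\<bar>u \<phi>\<bar> \<le> C * (\<Sum>is\<in>I. SUP x. \<bar>foldr pderiv_dir is \<phi> x\<bar>)"
      using CN[OF \<phi>] by (simp add: I_def)
    also have "\<dots> \<le> \<bar>C\<bar> * (\<Sum>is\<in>I. SUP x. \<bar>foldr pderiv_dir is \<phi> x\<bar>)"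
      using * by (intro mult_right_mono sum_nonneg) auto
    also have "\<dots> \<le> \<bar>C\<bar> * (card I * e)"
      using * by (intro mult_left_mono sum_bounded_above) auto
    finally show "\<bar>u \<phi>\<bar> \<le> \<bar>C\<bar> * card I * e" by (simp add: mult.assoc)
  qed simp
qed

section \<open>Superpositions of dilated translates\<close>

lemma sum_axis: "(\<Sum>j\<in>UNIV. axis i (1::real) $ j * f j) = f i"
proof -
  have "(\<Sum>j\<in>UNIV. axis i (1::real) $ j * f j) = (\<Sum>j\<in>UNIV. if j = i then f j else 0)"
    by (rule sum.cong) (auto simp: axis_def)
  then show ?thesis by simp
qed

text \<open>Kernels of different scales and centres, translates of a test function, and convolutions are all
  members of the family \<open>affine_copy\<close> or integrals over it. A derivative of a member is the copy of the
  derivative, with the coefficient multiplied by \<open>a\<close>; the variable coefficient keeps the family closed.\<close>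

definition affine_copy :: "real \<Rightarrow> real \<Rightarrow> real^'n \<Rightarrow> (real^'n \<Rightarrow> real) \<Rightarrow> real^'n \<Rightarrow> real" where
  "affine_copy c a b \<phi> = (\<lambda>x. c * \<phi> (a *\<^sub>R (x - b)))"

lemma has_derivative_affine_copy:
  assumes "\<phi> differentiable_on UNIV"
  shows "(affine_copy c a b \<phi> has_derivative
    (\<lambda>v. \<Sum>i\<in>UNIV. v $ i * affine_copy (c * a) a b (pderiv_dir i \<phi>) x)) (at x)"
proof -
  let ?y = "a *\<^sub>R (x - b)"
  let ?D = "frechet_derivative \<phi> (at ?y)"
  have D: "(\<phi> has_derivative ?D) (at ?y)"
    using differentiable_on_UNIV_has_derivative[OF assms] .
  then have lin: "linear ?D" by (simp add: has_derivative_linear)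
  have "?D v = (\<Sum>i\<in>UNIV. v $ i * pderiv_dir i \<phi> ?y)" for v
  proof -
    have "?D v = ?D (\<Sum>i\<in>UNIV. v $ i *s axis i 1)" by (simp add: basis_expansion)
    then show ?thesis by (simp add: linear_sum[OF lin] linear_scale[OF lin] pderiv_dir_def
          scalar_mult_eq_scaleR)
  qed
  note D_sum = this
  have "((\<lambda>x. a *\<^sub>R (x - b)) has_derivative (\<lambda>v. a *\<^sub>R v)) (at x)"
    by (auto intro!: derivative_eq_intros)
  from has_derivative_compose[OF this D]
  have "((\<lambda>x. c * \<phi> (a *\<^sub>R (x - b))) has_derivative (\<lambda>v. c * ?D (a *\<^sub>R v))) (at x)"
    by (auto intro!: derivative_eq_intros)
  then show ?thesis
    by (simp add: affine_copy_def D_sum linear_scale[OF lin] sum_distrib_left mult_ac)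
qed

lemma differentiable_affine_copy:
  "\<phi> differentiable_on UNIV \<Longrightarrow> affine_copy c a b \<phi> differentiable_on UNIV"
  using has_derivative_affine_copy[of \<phi> c a b]
  unfolding differentiable_on_def[of "affine_copy c a b \<phi>"] differentiable_def by blast

lemma pderiv_affine_copy:
  assumes "\<phi> differentiable_on UNIV"
  shows "pderiv_dir i (affine_copy c a b \<phi>) = affine_copy (c * a) a b (pderiv_dir i \<phi>)"
  by (rule ext, subst pderiv_dir_eqI[OF has_derivative_affine_copy[OF assms]])
    (rule sum_axis)

lemma smooth_affine_copy:
  assumes "smooth \<phi>" shows "smooth (affine_copy c a b \<phi>)"
proof (rule smooth_coinduct)
  let ?S = "{affine_copy c a b \<phi> |c \<phi>. smooth \<phi>}"
  show "affine_copy c a b \<phi> \<in> ?S" using assms by blast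
  fix g assume "g \<in> ?S"
  then obtain c \<phi> where g: "g = affine_copy c a b \<phi>" "smooth \<phi>" by blast
  show "g differentiable_on UNIV"
    unfolding g by (intro differentiable_affine_copy smooth_differentiable g)
  show "pderiv_dir i g \<in> ?S" for i
    using smooth_pderiv[OF g(2)] unfolding g pderiv_affine_copy[OF smooth_differentiable[OF g(2)]]
    by blast
qed

lemma foldr_pderiv_affine_copy:
  assumes "smooth \<phi>"
  shows "foldr pderiv_dir is (affine_copy c a b \<phi>) = affine_copy (c * a ^ length is) a b (foldr pderiv_dir is \<phi>)"
  by (induction "is")
    (simp_all add: pderiv_affine_copy smooth_differentiable smooth_foldr_pderiv assms mult_ac)

lemma continuous_on_affine_copy:
  assumes "smooth \<phi>" "continuous_on S a" "continuous_on S b" "continuous_on S c"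
    "continuous_on S x"
  shows "continuous_on S (\<lambda>p. affine_copy (c p) (a p) (b p) \<phi> (x p))"
  unfolding affine_copy_def
  by (intro continuous_intros continuous_on_compose2[OF smooth_continuous[OF assms(1), of UNIV]] assms)
    auto

definition superposition ::
    "'p::euclidean_space set \<Rightarrow> ('p \<Rightarrow> real) \<Rightarrow> ('p \<Rightarrow> real) \<Rightarrow> ('p \<Rightarrow> real^'n) \<Rightarrow>
      (real^'n \<Rightarrow> real) \<Rightarrow> real^'n \<Rightarrow> real" where
  "superposition S c a b \<phi> x = integral S (\<lambda>p. affine_copy (c p) (a p) (b p) \<phi> x)"

context
  fixes l r :: "'p::euclidean_space" and a :: "'p \<Rightarrow> real" and b :: "'p \<Rightarrow> real^'n"
  assumes cont: "continuous_on (cbox l r) a" "continuous_on (cbox l r) b"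
begin

text \<open>Differentiation under the integral sign. The parameter domain is a compact box, and the derivative,
  encoded as a bounded linear functional, depends continuously on the parameter and on the point.\<close>

lemma superposition_has_derivative:
  assumes "smooth \<phi>" "continuous_on (cbox l r) c"
  shows "(superposition (cbox l r) c a b \<phi> has_derivative
    (\<lambda>v. \<Sum>i\<in>UNIV. v $ i * superposition (cbox l r) (\<lambda>p. c p * a p) a b (pderiv_dir i \<phi>) x)) (at x)"
proof -
  define D :: "real^'n \<Rightarrow> 'p \<Rightarrow> (real^'n) \<Rightarrow>\<^sub>L real" where
    "D x p = (\<Sum>i\<in>UNIV. affine_copy (c p * a p) (a p) (b p) (pderiv_dir i \<phi>) x *\<^sub>R blinfun_inner_left (axis i 1))" for x p
  have D_apply: "blinfun_apply (D x p) =
      (\<lambda>v. \<Sum>i\<in>UNIV. v $ i * affine_copy (c p * a p) (a p) (b p) (pderiv_dir i \<phi>) x)" for x p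
    by (rule ext) (simp add: D_def blinfun.sum_left blinfun.scaleR_left inner_axis mult.commute)
  have sp: "smooth (pderiv_dir i \<phi>)" for i
    using assms(1) by (rule smooth_pderiv)
  have D_int: "D x integrable_on cbox l r" for x
    unfolding D_def
    by (intro integrable_continuous continuous_intros continuous_on_affine_copy sp cont assms)
  have "((\<lambda>x. integral (cbox l r) (\<lambda>p. affine_copy (c p) (a p) (b p) \<phi> x)) has_derivative
      blinfun_apply (integral (cbox l r) (D x))) (at x within UNIV)"
  proof (rule leibniz_rule)
    show "((\<lambda>x. affine_copy (c p) (a p) (b p) \<phi> x) has_derivative blinfun_apply (D x p)) (at x within UNIV)"
      for x p
      using has_derivative_affine_copy[OF smooth_differentiable[OF assms(1)]] by (simp add: D_apply)
    show "(\<lambda>p. affine_copy (c p) (a p) (b p) \<phi> x) integrable_on cbox l r" for x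
      by (intro integrable_continuous continuous_on_affine_copy assms cont continuous_intros)
    have "continuous_on (UNIV \<times> cbox l r) (\<lambda>z. D (fst z) (snd z))"
      unfolding D_def
      by (intro continuous_intros continuous_on_affine_copy sp
          continuous_on_compose2[OF cont(1)] continuous_on_compose2[OF cont(2)]
          continuous_on_compose2[OF assms(2)]) auto
    then show "continuous_on (UNIV \<times> cbox l r) (\<lambda>(x, p). D x p)"
      by (simp add: case_prod_beta)
  qed auto
  moreover have "blinfun_apply (integral (cbox l r) (D x)) =
    (\<lambda>v. \<Sum>i\<in>UNIV. v $ i * superposition (cbox l r) (\<lambda>p. c p * a p) a b (pderiv_dir i \<phi>) x)"
  proof
    fix v
    have int: "(\<lambda>p. affine_copy (c p * a p) (a p) (b p) (pderiv_dir i \<phi>) x) integrable_on cbox l r" for i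
      by (intro integrable_continuous continuous_on_affine_copy sp cont assms continuous_intros)
    have "blinfun_apply (integral (cbox l r) (D x)) v = integral (cbox l r) (\<lambda>p. D x p v)"
      by (rule blinfun_apply_integral[OF D_int])
    also have "\<dots> = (\<Sum>i\<in>UNIV. v $ i * superposition (cbox l r) (\<lambda>p. c p * a p) a b (pderiv_dir i \<phi>) x)"
      unfolding D_apply superposition_def
      by (subst integral_sum) (auto intro!: integrable_on_mult_right int)
    finally show "blinfun_apply (integral (cbox l r) (D x)) v = \<dots>" .
  qed
  ultimately show ?thesis by (simp add: superposition_def[abs_def])
qed

lemma superposition_differentiable:
  assumes "smooth \<phi>" "continuous_on (cbox l r) c"
  shows "superposition (cbox l r) c a b \<phi> differentiable_on UNIV"
  using superposition_has_derivative[OF assms] unfolding differentiable_on_def differentiable_def by blast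

lemma pderiv_superposition:
  assumes "smooth \<phi>" "continuous_on (cbox l r) c"
  shows "pderiv_dir i (superposition (cbox l r) c a b \<phi>) =
    superposition (cbox l r) (\<lambda>p. c p * a p) a b (pderiv_dir i \<phi>)"
  by (rule ext, subst pderiv_dir_eqI[OF superposition_has_derivative[OF assms]])
    (rule sum_axis)

lemma smooth_superposition:
  assumes "smooth \<phi>" "continuous_on (cbox l r) c"
  shows "smooth (superposition (cbox l r) c a b \<phi>)"
proof (rule smooth_coinduct)
  let ?S = "{superposition (cbox l r) c a b \<phi> |c \<phi>. smooth \<phi> \<and> continuous_on (cbox l r) c}"
  show "superposition (cbox l r) c a b \<phi> \<in> ?S" using assms by blast
  fix g assume "g \<in> ?S"
  then obtain c \<phi> where g: "g = superposition (cbox l r) c a b \<phi>"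
    and c: "smooth \<phi>" "continuous_on (cbox l r) c" by blast
  show "g differentiable_on UNIV"
    unfolding g by (intro superposition_differentiable c)
  show "pderiv_dir i g \<in> ?S" for i
    using smooth_pderiv[OF c(1)] continuous_on_mult[OF c(2) cont(1)]
    unfolding g pderiv_superposition[OF c] by blast
qed

lemma foldr_pderiv_superposition:
  assumes "smooth \<phi>" "continuous_on (cbox l r) c"
  shows "foldr pderiv_dir is (superposition (cbox l r) c a b \<phi>) =
    superposition (cbox l r) (\<lambda>p. c p * a p ^ length is) a b (foldr pderiv_dir is \<phi>)"
proof (induction "is")
  case (Cons i "is")
  have "continuous_on (cbox l r) (\<lambda>p. c p * a p ^ length is)"
    by (intro continuous_intros assms cont)
  then show ?case using Cons
    by (simp add: pderiv_superposition smooth_foldr_pderiv assms mult_ac)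
qed simp

end

section \<open>Interchanging a distribution with an integral\<close>

lemma riemann_sum_error:
  fixes g :: "'p::euclidean_space \<Rightarrow> real"
  assumes D: "D tagged_division_of cbox l r" and g: "g integrable_on cbox l r"
    and e: "\<And>t k s. (t, k) \<in> D \<Longrightarrow> s \<in> k \<Longrightarrow> \<bar>g s - g t\<bar> \<le> e"
  shows "\<bar>integral (cbox l r) g - (\<Sum>z\<in>D. measure lborel (snd z) * g (fst z))\<bar> \<le> e * measure lborel (cbox l r)"
proof -
  have bound: "\<bar>integral (snd z) g - measure lborel (snd z) * g (fst z)\<bar> \<le> e * measure lborel (snd z)" if "z \<in> D" for z
  proof -
    obtain t k where z: "z = (t, k)" by force
    then have tk: "t \<in> k" "k \<subseteq> cbox l r" "\<exists>a b. k = cbox a b"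
      using tagged_division_ofD(2-4)[OF D] that by auto
    then obtain a b where k: "k = cbox a b" by blast
    have "g integrable_on cbox a b"
      using integrable_on_subcbox[OF g] tk(2) k by simp
    then have "((\<lambda>s. g s - g t) has_integral (integral (cbox a b) g - measure lborel (cbox a b) *\<^sub>R g t)) (cbox a b)"
      by (intro has_integral_diff integrable_integral has_integral_const)
    moreover have "0 \<le> e"
      using e[of t k t] that z tk(1) by simp
    ultimately have "norm (integral (cbox a b) g - measure lborel (cbox a b) *\<^sub>R g t) \<le> e * measure lborel (cbox a b)"
      using e[of t k] that z k by (intro has_integral_bound) auto
    then show ?thesis using z k by simp
  qed
  have "integral (cbox l r) g = (\<Sum>z\<in>D. integral (snd z) g)"
    using integral_combine_tagged_division_topdown[OF g D] by (simp add: case_prod_beta)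
  then have "\<bar>integral (cbox l r) g - (\<Sum>z\<in>D. measure lborel (snd z) * g (fst z))\<bar>
      = \<bar>\<Sum>z\<in>D. (integral (snd z) g - measure lborel (snd z) * g (fst z))\<bar>"
    by (simp add: sum_subtractf)
  also have "\<dots> \<le> (\<Sum>z\<in>D. e * measure lborel (snd z))"
    by (rule order_trans[OF sum_abs sum_mono]) (rule bound)
  also have "\<dots> = e * measure lborel (cbox l r)"
    using additive_content_tagged_division[OF D] by (simp add: case_prod_beta flip: sum_distrib_left)
  finally show ?thesis .
qed

text \<open>On the compact set \<open>cbox l r \<times> K\<close> the function is uniformly continuous; off \<open>K\<close> there is nothing to compare.\<close>

lemma uniform_modulus:
  fixes g :: "'p::euclidean_space \<Rightarrow> 'b::metric_space \<Rightarrow> real"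
  assumes cont: "continuous_on (cbox l r \<times> UNIV) (\<lambda>z. g (fst z) (snd z))" and K: "compact K"
    and zero: "\<And>p x. p \<in> cbox l r \<Longrightarrow> x \<notin> K \<Longrightarrow> g p x = 0" and "e > 0"
  shows "\<exists>d>0. \<forall>p\<in>cbox l r. \<forall>p'\<in>cbox l r. \<forall>x. dist p p' < d \<longrightarrow> \<bar>g p x - g p' x\<bar> \<le> e"
proof -
  have "uniformly_continuous_on (cbox l r \<times> K) (\<lambda>z. g (fst z) (snd z))"
    by (intro compact_uniformly_continuous continuous_on_subset[OF cont] compact_Times K compact_cbox) auto
  from this[unfolded uniformly_continuous_on_def, rule_format, OF \<open>e > 0\<close>]
  obtain d where d: "d > 0" and *: "\<And>z z'. \<lbrakk>z \<in> cbox l r \<times> K; z' \<in> cbox l r \<times> K; dist z' z < d\<rbrakk>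
      \<Longrightarrow> dist (g (fst z') (snd z')) (g (fst z) (snd z)) < e"
    by blast
  have "\<bar>g p x - g p' x\<bar> \<le> e" if "p \<in> cbox l r" "p' \<in> cbox l r" "dist p p' < d" for p p' x
  proof (cases "x \<in> K")
    case True
    then show ?thesis
      using *[of "(p', x)" "(p, x)"] that by (simp add: dist_Pair_Pair dist_real_def)
  qed (use zero that \<open>e > 0\<close> in simp)
  then show ?thesis using d by blast
qed

text \<open>A continuous family of copies of one smooth function, all supported in a compact subset \<open>K\<close> of \<open>X\<close>. Such a
  family is uniformly continuous in the parameter for the seminorms that control \<open>u\<close>.\<close>

context
  fixes l r :: "'p::euclidean_space" and a c :: "'p \<Rightarrow> real" and b :: "'p \<Rightarrow> real^'n"
    and \<phi> :: "real^'n \<Rightarrow> real" and K X :: "(real^'n) set" and u :: "(real^'n \<Rightarrow> real) \<Rightarrow> real"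
  assumes cont: "continuous_on (cbox l r) a" "continuous_on (cbox l r) b" "continuous_on (cbox l r) c"
    and \<phi>: "smooth \<phi>" and u: "distribution_on X u" and K: "compact K" "K \<subseteq> X"
    and vanish: "\<And>p x. p \<in> cbox l r \<Longrightarrow> x \<notin> K \<Longrightarrow> affine_copy (c p) (a p) (b p) \<phi> x = 0"
begin

private abbreviation (input) "F p \<equiv> affine_copy (c p) (a p) (b p) \<phi>"

lemma affine_copy_test_function:
  "p \<in> cbox l r \<Longrightarrow> F p \<in> test_functions K"
  using vanish K by (intro test_functionsI[of _ K] smooth_affine_copy \<phi>) auto

lemma foldr_pderiv_copy_eq_0:
  assumes "p \<in> cbox l r" "x \<notin> K" shows "foldr pderiv_dir is (F p) x = 0"
proof -
  have "foldr pderiv_dir is (F p) \<in> test_functions K"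
    by (induction "is") (auto intro: test_functions_pderiv affine_copy_test_function[OF assms(1)])
  then show ?thesis using assms(2) by (rule test_functions_eq_0)
qed

lemma derivatives_modulus:
  assumes "e > 0"
  shows "\<exists>d>0. \<forall>p\<in>cbox l r. \<forall>p'\<in>cbox l r. \<forall>is x. dist p p' < d \<and> length is \<le> N \<longrightarrow>
     \<bar>foldr pderiv_dir is (F p) x - foldr pderiv_dir is (F p') x\<bar> \<le> e"
proof -
  have "\<exists>d>0. \<forall>p\<in>cbox l r. \<forall>p'\<in>cbox l r. \<forall>x. dist p p' < d \<longrightarrow>
     \<bar>foldr pderiv_dir is (F p) x - foldr pderiv_dir is (F p') x\<bar> \<le> e" for "is"
  proof (rule uniform_modulus[OF _ K(1)])
    show "continuous_on (cbox l r \<times> UNIV) (\<lambda>z. foldr pderiv_dir is (F (fst z)) (snd z))"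
      unfolding foldr_pderiv_affine_copy[OF \<phi>]
      by (intro continuous_on_affine_copy smooth_foldr_pderiv \<phi> continuous_intros
          continuous_on_compose2[OF cont(1)] continuous_on_compose2[OF cont(2)]
          continuous_on_compose2[OF cont(3)]) auto
  qed (use assms foldr_pderiv_copy_eq_0 in auto)
  then obtain d where d: "\<And>is. d is > 0"
    and le: "\<And>is p p' x. \<lbrakk>p \<in> cbox l r; p' \<in> cbox l r; dist p p' < d is\<rbrakk> \<Longrightarrow>
     \<bar>foldr pderiv_dir is (F p) x - foldr pderiv_dir is (F p') x\<bar> \<le> e"
    by metis
  define I :: "'n list set" where "I = {is. length is \<le> N}"
  have fin: "finite I"
    using finite_lists_length_le[of "UNIV :: 'n set" N] by (simp add: I_def)
  have "[] \<in> I" by (simp add: I_def)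
  then have "Min (d ` I) > 0" using fin d by (subst Min_gr_iff) auto
  moreover have "Min (d ` I) \<le> d is" if "length is \<le> N" for "is"
    using that fin by (intro Min_le) (auto simp: I_def)
  ultimately show ?thesis using le by (meson less_le_trans)
qed

lemma continuous_distribution_copy: "continuous_on (cbox l r) (\<lambda>p. u (F p))"
proof -
  obtain M N where M: "M \<ge> 0" and bound:
    "\<And>\<phi> e. \<lbrakk>\<phi> \<in> test_functions K; \<And>is x. length is \<le> N \<Longrightarrow> \<bar>foldr pderiv_dir is \<phi> x\<bar> \<le> e\<rbrakk>
      \<Longrightarrow> \<bar>u \<phi>\<bar> \<le> M * e"
    using distribution_bound[OF u K] by blast
  show ?thesis
    unfolding continuous_on_iff
  proof (intro ballI allI impI)
    fix p and e :: real assume p: "p \<in> cbox l r" and "e > 0"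
    define e' where "e' = e / (M + 1)"
    have "e' > 0" using M \<open>e > 0\<close> by (simp add: e'_def)
    from derivatives_modulus[OF this, of N] obtain d where "d > 0" and
      d: "\<And>p p' is x. \<lbrakk>p \<in> cbox l r; p' \<in> cbox l r; dist p p' < d; length is \<le> N\<rbrakk> \<Longrightarrow>
       \<bar>foldr pderiv_dir is (F p) x - foldr pderiv_dir is (F p') x\<bar> \<le> e'"
      by blast
    have "dist (u (F p')) (u (F p)) < e" if p': "p' \<in> cbox l r" "dist p' p < d" for p'
    proof -
      note t = affine_copy_test_function[OF p] affine_copy_test_function[OF p'(1)]
      have "\<bar>u (\<lambda>x. 1 * F p' x + (-1) * F p x)\<bar> \<le> M * e'"
        using d[OF p'(1) p p'(2)]
        by (intro bound test_functions_lincomb t)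
          (simp only: foldr_pderiv_lincomb[OF test_functionsD(1)[OF t(2)] test_functionsD(1)[OF t(1)]], simp)
      also have "u (\<lambda>x. 1 * F p' x + (-1) * F p x) = u (F p') - u (F p)"
        using t K(2) by (subst distribution_lincomb[OF u]) (auto intro: test_functions_mono)
      also have "M * e' < e"
        using M \<open>e > 0\<close> by (simp add: e'_def field_simps)
      finally show ?thesis by (simp add: dist_real_def)
    qed
    then show "\<exists>d>0. \<forall>p'\<in>cbox l r. dist p' p < d \<longrightarrow> dist (u (F p')) (u (F p)) < e"
      using \<open>d > 0\<close> by blast
  qed
qed

lemma superposition_eq_0: "x \<notin> K \<Longrightarrow> superposition (cbox l r) c a b \<phi> x = 0"
  unfolding superposition_def using vanish by (subst integral_cong[where g = "\<lambda>p. 0"]) auto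

lemma superposition_test_function: "superposition (cbox l r) c a b \<phi> \<in> test_functions K"
  by (rule test_functionsI[OF smooth_superposition[OF cont(1,2) \<phi> cont(3)] K(1) order_refl
        superposition_eq_0])

text \<open>Both sides are approximated by the same Riemann sum \<open>R\<close>. Derivatives pass through the integral and
  through the sum, so all derivatives of \<open>R\<close> are uniformly close to those of the superposition, and \<open>u\<close> is
  linear on \<open>R\<close>.\<close>

lemma distribution_superposition:
  "u (superposition (cbox l r) c a b \<phi>) = integral (cbox l r) (\<lambda>p. u (F p))"
proof -
  obtain M N where M: "M \<ge> 0" and bound:
    "\<And>\<phi> e. \<lbrakk>\<phi> \<in> test_functions K; \<And>is x. length is \<le> N \<Longrightarrow> \<bar>foldr pderiv_dir is \<phi> x\<bar> \<le> e\<rbrakk>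
      \<Longrightarrow> \<bar>u \<phi>\<bar> \<le> M * e"
    using distribution_bound[OF u K] by blast
  define S where "S = superposition (cbox l r) c a b \<phi>"
  define V where "V = measure lborel (cbox l r)"
  have "\<bar>u S - integral (cbox l r) (\<lambda>p. u (F p))\<bar> \<le> e * ((M + 1) * V)" if "e > 0" for e
  proof -
    obtain d where "d > 0" and
      d: "\<And>p p' is x. \<lbrakk>p \<in> cbox l r; p' \<in> cbox l r; dist p p' < d; length is \<le> N\<rbrakk> \<Longrightarrow>
       \<bar>foldr pderiv_dir is (F p) x - foldr pderiv_dir is (F p') x\<bar> \<le> e"
      using derivatives_modulus[OF \<open>e > 0\<close>, of N] by blast
    have "uniformly_continuous_on (cbox l r) (\<lambda>p. u (F p))"
      by (intro compact_uniformly_continuous continuous_distribution_copy compact_cbox)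
    then obtain d' where "d' > 0" and
      d': "\<And>p p'. \<lbrakk>p \<in> cbox l r; p' \<in> cbox l r; dist p' p < d'\<rbrakk> \<Longrightarrow> dist (u (F p')) (u (F p)) < e"
      unfolding uniformly_continuous_on_def using \<open>e > 0\<close> by meson
    obtain D where D: "D tagged_division_of cbox l r" and fine: "(\<lambda>x. ball x (min d d')) fine D"
      using fine_division_exists[OF gauge_ball] \<open>d > 0\<close> \<open>d' > 0\<close> by (metis min_less_iff_conj)
    have tag: "fst z \<in> cbox l r" if "z \<in> D" for z
      using tagged_division_ofD(2,3)[OF D, of "fst z" "snd z"] that by auto
    have close: "t \<in> cbox l r" "s \<in> cbox l r" "dist s t < d" "dist s t < d'"
      if "(t, k) \<in> D" "s \<in> k" for t k s
    proof -
      have "k \<subseteq> ball t (min d d')" using fine that by (auto simp: fine_def)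
      then have "dist t s < min d d'" using that by (auto simp: subset_iff)
      then show "dist s t < d" "dist s t < d'" by (simp_all add: dist_commute)
      show "t \<in> cbox l r" "s \<in> cbox l r" using tagged_division_ofD(2,3)[OF D that(1)] that by auto
    qed
    \<comment> \<open>the Riemann sum; a tagged piece \<open>z\<close> is the pair of its tag and its box\<close>
    define R where "R = (\<lambda>x. \<Sum>z\<in>D. measure lborel (snd z) * F (fst z) x)"
    have R: "R \<in> test_functions K"
      unfolding R_def by (intro test_functions_sum affine_copy_test_function tag)
    have S: "S \<in> test_functions K" unfolding S_def by (rule superposition_test_function)
    have err: "\<bar>foldr pderiv_dir is (\<lambda>x. 1 * S x + (-1) * R x) x\<bar> \<le> e * V" if "length is \<le> N" for "is" x
    proof -
      have "foldr pderiv_dir is S x = integral (cbox l r) (\<lambda>p. foldr pderiv_dir is (F p) x)"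
        unfolding S_def foldr_pderiv_superposition[OF cont(1,2) \<phi> cont(3)] foldr_pderiv_affine_copy[OF \<phi>]
        by (simp add: superposition_def)
      moreover have "foldr pderiv_dir is R x = (\<Sum>z\<in>D. measure lborel (snd z) * foldr pderiv_dir is (F (fst z)) x)"
        unfolding R_def by (subst foldr_pderiv_sum) (auto intro: smooth_affine_copy \<phi>)
      moreover have "\<bar>integral (cbox l r) (\<lambda>p. foldr pderiv_dir is (F p) x)
          - (\<Sum>z\<in>D. measure lborel (snd z) * foldr pderiv_dir is (F (fst z)) x)\<bar> \<le> e * V"
        unfolding V_def
      proof (rule riemann_sum_error[OF D])
        show "(\<lambda>p. foldr pderiv_dir is (F p) x) integrable_on cbox l r"
          unfolding foldr_pderiv_affine_copy[OF \<phi>]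
          by (intro integrable_continuous continuous_on_affine_copy smooth_foldr_pderiv \<phi> cont continuous_intros)
        show "\<bar>foldr pderiv_dir is (F s) x - foldr pderiv_dir is (F t) x\<bar> \<le> e"
          if "(t, k) \<in> D" "s \<in> k" for t k s
          using close[OF that] d \<open>length is \<le> N\<close> by blast
      qed
      ultimately show ?thesis
        using foldr_pderiv_lincomb[OF test_functionsD(1)[OF S] test_functionsD(1)[OF R], of "is" 1 "-1"]
        by simp
    qed
    have "\<bar>u (\<lambda>x. 1 * S x + (-1) * R x)\<bar> \<le> M * (e * V)"
      by (intro bound test_functions_lincomb S R err)
    moreover have "u (\<lambda>x. 1 * S x + (-1) * R x) = u S - u R"
      using S R K(2) by (subst distribution_lincomb[OF u]) (auto intro: test_functions_mono)
    moreover have "u R = (\<Sum>z\<in>D. measure lborel (snd z) * u (F (fst z)))"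
      unfolding R_def using tag K(2)
      by (intro distribution_sum[OF u] test_functions_mono[OF affine_copy_test_function]) auto
    moreover have "\<bar>integral (cbox l r) (\<lambda>p. u (F p)) - (\<Sum>z\<in>D. measure lborel (snd z) * u (F (fst z)))\<bar> \<le> e * V"
      unfolding V_def
    proof (rule riemann_sum_error[OF D])
      show "(\<lambda>p. u (F p)) integrable_on cbox l r"
        by (intro integrable_continuous continuous_distribution_copy)
      show "\<bar>u (F s) - u (F t)\<bar> \<le> e" if "(t, k) \<in> D" "s \<in> k" for t k s
        using d'[OF close(1)[OF that] close(2)[OF that]] close(4)[OF that] by (simp add: dist_real_def)
    qed
    ultimately have "\<bar>u S - integral (cbox l r) (\<lambda>p. u (F p))\<bar> \<le> M * (e * V) + e * V" by linarith
    then show ?thesis by (simp add: algebra_simps)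
  qed
  note small = this
  have "V \<ge> 0" by (simp add: V_def)
  have "\<bar>u S - integral (cbox l r) (\<lambda>p. u (F p))\<bar> \<le> 0 + e" if "e > 0" for e
  proof -
    define W where "W = (M + 1) * V"
    have W: "W \<ge> 0" using M \<open>V \<ge> 0\<close> by (simp add: W_def)
    have "e / (W + 1) > 0" using that W by simp
    from small[OF this] have "\<bar>u S - integral (cbox l r) (\<lambda>p. u (F p))\<bar> \<le> e / (W + 1) * W"
      by (simp add: W_def)
    also have "\<dots> \<le> e"
      using that W by (simp add: field_simps)
    finally show ?thesis by simp
  qed
  then have "\<bar>u S - integral (cbox l r) (\<lambda>p. u (F p))\<bar> \<le> 0" by (rule field_le_epsilon)
  then show ?thesis by (simp add: S_def)
qed

end

section \<open>The elliptic operator and its ellipsoidal kernels\<close>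

lemma smooth_has_derivative:
  assumes "smooth \<phi>"
  shows "(\<phi> has_derivative (\<lambda>v. \<Sum>i\<in>UNIV. v $ i * pderiv_dir i \<phi> x)) (at x)"
  using has_derivative_affine_copy[OF smooth_differentiable[OF assms], of 1 1 0 x]
  by (simp add: affine_copy_def)

definition elliptic_op :: "real^'n^'n \<Rightarrow> (real^'n \<Rightarrow> real) \<Rightarrow> real^'n \<Rightarrow> real" where
  "elliptic_op A \<phi> x = (\<Sum>i\<in>UNIV. \<Sum>j\<in>UNIV. A $ i $ j * pderiv_dir j (pderiv_dir i \<phi>) x)"

lemma elliptic_op_superposition:
  assumes "continuous_on (cbox l r) a" "continuous_on (cbox l r) b" "continuous_on (cbox l r) c" "smooth \<phi>"
  shows "elliptic_op A (superposition (cbox l r) c a b \<phi>) =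
    superposition (cbox l r) (\<lambda>p. c p * a p * a p) a b (elliptic_op A \<phi>)"
proof
  fix x
  have c1: "continuous_on (cbox l r) (\<lambda>p. c p * a p)" and c2: "continuous_on (cbox l r) (\<lambda>p. c p * a p * a p)"
    by (intro continuous_intros assms)+
  have int: "(\<lambda>p. affine_copy (c p * a p * a p) (a p) (b p) (pderiv_dir j (pderiv_dir i \<phi>)) x) integrable_on cbox l r"
    for i j
    by (intro integrable_continuous continuous_on_affine_copy smooth_pderiv assms c2 continuous_intros)
  have "elliptic_op A (superposition (cbox l r) c a b \<phi>) x = (\<Sum>i\<in>UNIV. \<Sum>j\<in>UNIV.
      A $ i $ j * superposition (cbox l r) (\<lambda>p. c p * a p * a p) a b (pderiv_dir j (pderiv_dir i \<phi>)) x)"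
    unfolding elliptic_op_def
    by (simp add: pderiv_superposition[OF assms(1,2) assms(4,3)]
        pderiv_superposition[OF assms(1,2) smooth_pderiv[OF assms(4)] c1])
  also have "\<dots> = integral (cbox l r) (\<lambda>p. \<Sum>i\<in>UNIV. \<Sum>j\<in>UNIV.
      A $ i $ j * affine_copy (c p * a p * a p) (a p) (b p) (pderiv_dir j (pderiv_dir i \<phi>)) x)"
    unfolding superposition_def
    by (simp add: integral_sum integrable_sum integrable_on_mult_right int)
  also have "\<dots> = superposition (cbox l r) (\<lambda>p. c p * a p * a p) a b (elliptic_op A \<phi>) x"
    unfolding superposition_def elliptic_op_def
    by (simp add: affine_copy_def sum_distrib_left mult_ac)
  finally show "elliptic_op A (superposition (cbox l r) c a b \<phi>) x = \<dots>" .
qed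

text \<open>In the application \<open>A\<close> is positive definite and \<open>B\<close> is its inverse. The radius \<open>R\<close> expresses that the
  ellipsoid of \<open>B\<close>, which will carry the kernels, is bounded.\<close>

locale ellipsoid =
  fixes A B :: "real^'n^'n" and R :: real
  assumes A_sym: "transpose A = A" and B_sym: "transpose B = B" and AB: "A ** B = mat 1"
    and R_pos: "R > 0" and R: "\<And>x. x \<bullet> (B *v x) < 1 \<Longrightarrow> norm x \<le> R"
begin

definition quad :: "real^'n \<Rightarrow> real" where "quad x = x \<bullet> (B *v x)"
text \<open>The factor \<open>2\<close> and the index \<open>2\<close> in \<open>H\<close> come from \<open>flat 0\<close> having derivative \<open>flat 2\<close> and \<open>quad\<close> having
  gradient \<open>2 *\<^sub>R (B *v x)\<close>: with them the gradient of \<open>G\<close> is exactly \<open>- H x *\<^sub>R (B *v x)\<close>.\<close>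

definition G :: "real^'n \<Rightarrow> real" where "G x = flat 0 (1 - quad x)"
definition H :: "real^'n \<Rightarrow> real" where "H x = 2 * flat 2 (1 - quad x)"

lemma matrix_component_deriv:
  "smooth (\<lambda>x. (B *v x) $ k)" "pderiv_dir i (\<lambda>x. (B *v x) $ k) = (\<lambda>x. B $ i $ k)"
proof -
  have bl: "bounded_linear (\<lambda>x. (B *v x) $ k)"
    by (intro bounded_linear_compose[OF bounded_linear_vec_nth] matrix_vector_mul_bounded_linear)
  then show "smooth (\<lambda>x. (B *v x) $ k)" by (rule smooth_bounded_linear)
  have "(B *v axis i 1) $ k = B $ i $ k"
    using B_sym by (metis column_def matrix_vector_mult_basis transpose_def vec_lambda_beta)
  then show "pderiv_dir i (\<lambda>x. (B *v x) $ k) = (\<lambda>x. B $ i $ k)"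
    by (intro ext trans[OF pderiv_dir_eqI[OF bounded_linear_imp_has_derivative[OF bl]]])
qed

lemma quad_deriv: "smooth quad" "pderiv_dir i quad = (\<lambda>x. 2 * (B *v x) $ i)"
proof -
  have "smooth (\<lambda>x::real^'n. x $ k)" for k
    by (rule smooth_bounded_linear) (rule bounded_linear_vec_nth)
  then have "smooth (\<lambda>x. \<Sum>k\<in>UNIV. x $ k * (B *v x) $ k)"
    by (intro smooth_sum smooth_mult matrix_component_deriv(1))
  then show "smooth quad"
    by (simp add: quad_def[abs_def] inner_vec_def)
  have "(quad has_derivative (\<lambda>v. x \<bullet> (B *v v) + v \<bullet> (B *v x))) (at x)" for x
    unfolding quad_def[abs_def]
    by (intro derivative_intros bounded_linear_imp_has_derivative matrix_vector_mul_bounded_linear)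
  then have "pderiv_dir i quad x = x \<bullet> (B *v axis i 1) + axis i 1 \<bullet> (B *v x)" for x
    by (rule pderiv_dir_eqI)
  moreover have "x \<bullet> (B *v axis i 1) = axis i 1 \<bullet> (B *v x)" for x
    using dot_lmul_matrix[of x B "axis i 1"] B_sym
    by (metis inner_commute transpose_matrix_vector)
  ultimately show "pderiv_dir i quad = (\<lambda>x. 2 * (B *v x) $ i)"
    by (simp add: inner_axis' fun_eq_iff)
qed

lemma smooth_GH: "smooth G" "smooth H"
proof -
  have "smooth (\<lambda>x. 1 - quad x)" by (intro smooth_diff smooth_const quad_deriv)
  then have "smooth (\<lambda>x. flat k (1 - quad x))" for k by (rule smooth_flat_compose)
  then show "smooth G" "smooth H"
    unfolding G_def[abs_def] H_def[abs_def] by (intro smooth_mult smooth_const | simp)+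
qed

lemma GH_nonneg: "G x \<ge> 0" "H x \<ge> 0"
  by (simp_all add: G_def H_def flat_nonneg)

lemma GH_eq_0: "norm x > R \<Longrightarrow> G x = 0" "norm x > R \<Longrightarrow> H x = 0"
  using R[of x] by (auto simp: G_def H_def quad_def flat_def)

lemma pderiv_G: "pderiv_dir i G = (\<lambda>x. (-1) * (H x * (B *v x) $ i))"
proof -
  have sm: "(\<lambda>x. 1 - quad x) differentiable_on UNIV"
    by (intro smooth_differentiable smooth_diff smooth_const quad_deriv)
  have "pderiv_dir i (\<lambda>x::real^'n. 1 :: real) x = 0" for x
    by (rule pderiv_dir_eqI[OF has_derivative_const])
  then have "pderiv_dir i (\<lambda>x. 1 - quad x) = (\<lambda>x. - 2 * (B *v x) $ i)"
    using pderiv_dir_lincomb[OF smooth_differentiable[OF smooth_const[of 1]]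
        smooth_differentiable[OF quad_deriv(1)], of i 1 "-1"]
    by (simp add: quad_deriv fun_eq_iff)
  then show ?thesis
    using pderiv_dir_compose[OF sm flat_DERIV[of 0], of i]
    unfolding G_def[abs_def] H_def by (simp add: fun_eq_iff numeral_2_eq_2)
qed

text \<open>Since \<open>B\<close> inverts \<open>A\<close>, the field \<open>A\<close> times the gradient of \<open>G\<close> is the radial field \<open>- H x *\<^sub>R x\<close>, and the
  operator applied to \<open>G\<close> is its divergence. The two terms are those of the derivative of
  \<open>s ^ CARD('n) * H (s *\<^sub>R x)\<close> in \<open>s\<close>.\<close>

lemma elliptic_op_G:
  "elliptic_op A G x = - (real CARD('n) * H x + (\<Sum>j\<in>UNIV. x $ j * pderiv_dir j H x))"
proof -
  have BA: "B ** A = mat 1"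
    using AB matrix_left_right_inverse by blast
  have comp: "(\<Sum>i\<in>UNIV. A $ i $ j * (B *v x) $ i) = x $ j" for j
  proof -
    have "(\<Sum>i\<in>UNIV. A $ i $ j * (B *v x) $ i) = (transpose A *v (B *v x)) $ j"
      by (simp add: matrix_vector_mult_def transpose_def)
    also have "\<dots> = x $ j"
      by (simp add: A_sym AB matrix_vector_mul_assoc)
    finally show ?thesis .
  qed
  have tr: "(\<Sum>i\<in>UNIV. \<Sum>j\<in>UNIV. A $ i $ j * B $ j $ i) = real CARD('n)"
    using arg_cong[OF AB, of trace] by (simp add: trace_def matrix_matrix_mult_def mat_def)
  have "pderiv_dir j (pderiv_dir i G) x = - (H x * B $ j $ i + pderiv_dir j H x * (B *v x) $ i)" for i j
  proof -
    have d: "(\<lambda>x. H x * (B *v x) $ i) differentiable_on UNIV"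
      by (intro smooth_differentiable smooth_mult smooth_GH matrix_component_deriv)
    have "pderiv_dir j (pderiv_dir i G) = (\<lambda>x. (-1) * pderiv_dir j (\<lambda>x. H x * (B *v x) $ i) x)"
      unfolding pderiv_G using pderiv_dir_lincomb[OF d d, of j "-1" 0] by simp
    then show ?thesis
      by (simp add: pderiv_dir_mult smooth_differentiable smooth_GH matrix_component_deriv)
  qed
  then have "elliptic_op A G x = (\<Sum>i\<in>UNIV. \<Sum>j\<in>UNIV.
      - (H x * (A $ i $ j * B $ j $ i) + pderiv_dir j H x * (A $ i $ j * (B *v x) $ i)))"
    unfolding elliptic_op_def by (intro sum.cong refl) (simp only:, simp add: algebra_simps)
  also have "\<dots> = - (H x * (\<Sum>i\<in>UNIV. \<Sum>j\<in>UNIV. A $ i $ j * B $ j $ i)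
      + (\<Sum>i\<in>UNIV. \<Sum>j\<in>UNIV. pderiv_dir j H x * (A $ i $ j * (B *v x) $ i)))"
    by (simp only: sum_distrib_left sum.distrib sum_negf)
  also have "(\<Sum>i\<in>UNIV. \<Sum>j\<in>UNIV. pderiv_dir j H x * (A $ i $ j * (B *v x) $ i))
      = (\<Sum>j\<in>UNIV. x $ j * pderiv_dir j H x)"
    by (subst sum.swap) (simp only: comp mult.commute[of "x $ _"] flip: sum_distrib_left)
  finally show ?thesis by (simp add: tr mult.commute)
qed

abbreviation kernel :: "real \<Rightarrow> real^'n \<Rightarrow> real^'n \<Rightarrow> real" where
  "kernel s y \<equiv> affine_copy (s ^ CARD('n)) s y H"

lemma kernel_nonneg: "s > 0 \<Longrightarrow> kernel s y x \<ge> 0"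
  by (simp add: affine_copy_def GH_nonneg)

lemma affine_copy_GH_eq_0:
  assumes "s > 0" "x \<notin> cball y (R / s)"
  shows "affine_copy c s y G x = 0" "affine_copy c s y H x = 0"
proof -
  have "norm (s *\<^sub>R (x - y)) > R"
    unfolding norm_scaleR using assms by (simp add: dist_norm field_simps norm_minus_commute)
  then show "affine_copy c s y G x = 0" "affine_copy c s y H x = 0"
    using GH_eq_0 by (simp_all add: affine_copy_def)
qed

lemma kernel_test_function:
  "s > 0 \<Longrightarrow> cball y (R / s) \<subseteq> X \<Longrightarrow> kernel s y \<in> test_functions X"
  using affine_copy_GH_eq_0(2)
  by (intro test_functionsI[of _ "cball y (R / s)"] smooth_affine_copy smooth_GH) auto

text \<open>By \<open>elliptic_op_G\<close> the derivative of the kernel in the scale \<open>p\<close> is \<open>- (p ^ n / p)\<close> times the operator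
  applied to \<open>G\<close>, evaluated at \<open>p *\<^sub>R (x - y)\<close>. Two derivatives of a copy of \<open>G\<close> with dilation \<open>p\<close> produce a factor
  \<open>p\<^sup>2\<close>, hence the coefficient \<open>p ^ n / p ^ 3\<close> in \<open>\<psi>\<close>; it is written as a quotient because \<open>n\<close> may be less
  than \<open>3\<close>. The first claim is then the fundamental theorem of calculus.\<close>

lemma kernel_diff:
  fixes s t :: real and y :: "real^'n"
  assumes "0 < s" "s \<le> t"
  defines "\<psi> \<equiv> superposition (cbox s t) (\<lambda>p. p ^ CARD('n) / p ^ 3) (\<lambda>p. p) (\<lambda>p. y) G"
  shows "elliptic_op A \<psi> = (\<lambda>x. kernel s y x - kernel t y x)"
    and "\<psi> x \<ge> 0"
    and "\<psi> \<in> test_functions (cball y (R / s))"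
proof -
  let ?n = "CARD('n)"
  have cont: "continuous_on (cbox s t) (\<lambda>p. p ^ ?n / p ^ 3)"
    using assms by (intro continuous_intros) auto
  have zero: "affine_copy (p ^ ?n / p ^ 3) p y G x = 0" if "p \<in> cbox s t" "x \<notin> cball y (R / s)" for p x
  proof (rule affine_copy_GH_eq_0(1))
    have "R / p \<le> R / s" using that assms R_pos by (intro divide_left_mono) auto
    then show "x \<notin> cball y (R / p)" using that by auto
  qed (use that assms in auto)
  have "smooth \<psi>"
    unfolding \<psi>_def by (intro smooth_superposition continuous_intros cont smooth_GH)
  then show "\<psi> \<in> test_functions (cball y (R / s))"
  proof (rule test_functionsI[OF _ compact_cball order_refl])
    fix x assume "x \<notin> cball y (R / s)"
    then have "\<psi> x = integral (cbox s t) (\<lambda>p. 0)"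
      unfolding \<psi>_def superposition_def by (intro integral_cong zero)
    then show "\<psi> x = 0" by simp
  qed
  show "\<psi> x \<ge> 0"
    unfolding \<psi>_def superposition_def using assms GH_nonneg
    by (intro integral_nonneg integrable_continuous continuous_on_affine_copy smooth_GH cont continuous_intros)
      (auto simp: affine_copy_def)
  show "elliptic_op A \<psi> = (\<lambda>x. kernel s y x - kernel t y x)"
  proof
    fix x
    define z where "z = x - y"
    define f where "f p = p ^ ?n * H (p *\<^sub>R z)" for p
    have deriv: "(f has_vector_derivative - (p ^ ?n / p) * elliptic_op A G (p *\<^sub>R z)) (at p)" if "p > 0" for p
    proof -
      have "((\<lambda>p. H (p *\<^sub>R z)) has_derivative (\<lambda>h. \<Sum>i\<in>UNIV. (h *\<^sub>R z) $ i * pderiv_dir i H (p *\<^sub>R z))) (at p)"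
        by (rule has_derivative_compose[OF _ smooth_has_derivative[OF smooth_GH(2)]])
          (auto intro!: derivative_eq_intros)
      moreover have "(\<lambda>h. \<Sum>i\<in>UNIV. (h *\<^sub>R z) $ i * pderiv_dir i H (p *\<^sub>R z))
          = (*) (\<Sum>i\<in>UNIV. z $ i * pderiv_dir i H (p *\<^sub>R z))"
        by (simp add: fun_eq_iff sum_distrib_left mult_ac)
      ultimately have "((\<lambda>p. H (p *\<^sub>R z)) has_real_derivative (\<Sum>i\<in>UNIV. z $ i * pderiv_dir i H (p *\<^sub>R z))) (at p)"
        by (simp only: has_field_derivative_def)
      then have "(f has_real_derivative real ?n * p ^ (?n - 1) * H (p *\<^sub>R z)
          + p ^ ?n * (\<Sum>i\<in>UNIV. z $ i * pderiv_dir i H (p *\<^sub>R z))) (at p)"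
        unfolding f_def by (auto intro!: derivative_eq_intros)
      moreover have "real ?n * p ^ (?n - 1) * H (p *\<^sub>R z)
          + p ^ ?n * (\<Sum>i\<in>UNIV. z $ i * pderiv_dir i H (p *\<^sub>R z))
          = - (p ^ ?n / p) * elliptic_op A G (p *\<^sub>R z)"
      proof -
        have pow: "p ^ (?n - 1) = p ^ ?n / p"
          using that by (simp add: power_diff)
        have S: "(\<Sum>i\<in>UNIV. (p *\<^sub>R z) $ i * pderiv_dir i H (p *\<^sub>R z))
          = p * (\<Sum>i\<in>UNIV. z $ i * pderiv_dir i H (p *\<^sub>R z))"
          by (simp add: sum_distrib_left mult_ac)
        show ?thesis
          unfolding elliptic_op_G pow S using that by (simp add: field_simps)
      qed
      ultimately have "(f has_real_derivative - (p ^ ?n / p) * elliptic_op A G (p *\<^sub>R z)) (at p)"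
        by (rule back_subst)
      then show ?thesis
        by (simp only: has_real_derivative_iff_has_vector_derivative)
    qed
    have "((\<lambda>p. - (p ^ ?n / p) * elliptic_op A G (p *\<^sub>R z)) has_integral f t - f s) {s..t}"
    proof (rule fundamental_theorem_of_calculus)
      fix p assume "p \<in> {s..t}"
      then have "p > 0" using assms by simp
      then show "(f has_vector_derivative - (p ^ ?n / p) * elliptic_op A G (p *\<^sub>R z)) (at p within {s..t})"
        by (rule has_vector_derivative_at_within[OF deriv])
    qed fact
    from has_integral_neg[OF this]
    have "((\<lambda>p. (p ^ ?n / p) * elliptic_op A G (p *\<^sub>R z)) has_integral f s - f t) (cbox s t)"
      by simp
    then have "((\<lambda>p. affine_copy (p ^ ?n / p ^ 3 * p * p) p y (elliptic_op A G) x) has_integral f s - f t) (cbox s t)"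
      using assms by (elim has_integral_eq[rotated]) (auto simp: affine_copy_def z_def power3_eq_cube)
    then have "superposition (cbox s t) (\<lambda>p. p ^ ?n / p ^ 3 * p * p) (\<lambda>p. p) (\<lambda>p. y) (elliptic_op A G) x = f s - f t"
      unfolding superposition_def by (rule integral_unique)
    then show "elliptic_op A \<psi> x = kernel s y x - kernel t y x"
      unfolding \<psi>_def
      by (subst elliptic_op_superposition[OF _ _ cont smooth_GH(1)]) (auto intro!: continuous_intros simp: f_def z_def affine_copy_def)
  qed
qed

text \<open>The substitution \<open>z = s *\<^sub>R (x - y)\<close> turns an average of \<open>\<phi>\<close> against kernels into an average of translates of
  \<open>\<phi>\<close> against the fixed bump \<open>H\<close>, which makes the limit \<open>s \<longrightarrow> \<infinity>\<close> visible.\<close>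

lemma kernel_has_integral:
  fixes \<phi> :: "real^'n \<Rightarrow> real"
  assumes "s > 0" "smooth \<phi>" and lr: "cball 0 R \<subseteq> cbox l r"
  shows "((\<lambda>y. \<phi> y * kernel s y x) has_integral integral (cbox l r) (\<lambda>z. H z * \<phi> (x - z /\<^sub>R s))) UNIV"
proof -
    let ?f = "\<lambda>z. H z * \<phi> (x - z /\<^sub>R s)"
    let ?T = "\<lambda>z. (1 / - s) *\<^sub>R z + - ((1 / - s) *\<^sub>R (s *\<^sub>R x))"
    have "?f integrable_on cbox l r"
      by (intro integrable_continuous continuous_intros continuous_on_compose2[OF smooth_continuous[OF assms(2), of UNIV]]
          smooth_continuous smooth_GH) auto
    then have "((\<lambda>y. ?f ((- s) *\<^sub>R y + s *\<^sub>R x)) has_integral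
        (1 / \<bar>- s\<bar> ^ DIM(real^'n)) *\<^sub>R integral (cbox l r) ?f) (?T ` cbox l r)"
      using assms by (intro has_integral_affinity integrable_integral) auto
    then have "((\<lambda>y. s ^ CARD('n) * ?f ((- s) *\<^sub>R y + s *\<^sub>R x)) has_integral
        s ^ CARD('n) * ((1 / \<bar>- s\<bar> ^ DIM(real^'n)) *\<^sub>R integral (cbox l r) ?f)) (?T ` cbox l r)"
      by (rule has_integral_mult_right)
    moreover have "s ^ CARD('n) * ?f ((- s) *\<^sub>R y + s *\<^sub>R x) = \<phi> y * kernel s y x" for y
      using assms by (simp add: affine_copy_def algebra_simps)
    ultimately have "((\<lambda>y. \<phi> y * kernel s y x) has_integral integral (cbox l r) ?f) (?T ` cbox l r)"
      using assms by simp
    moreover have "\<phi> y * kernel s y x = 0" if "y \<notin> ?T ` cbox l r" for y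
    proof -
      have "y = ?T (s *\<^sub>R (x - y))" using assms by (simp add: algebra_simps)
      then have "s *\<^sub>R (x - y) \<notin> cbox l r" using that by blast
      then have "norm (s *\<^sub>R (x - y)) > R" using lr by (metis mem_cball_0 not_le subsetD)
      then show ?thesis using GH_eq_0 by (simp add: affine_copy_def)
    qed
    ultimately show "((\<lambda>y. \<phi> y * kernel s y x) has_integral integral (cbox l r) ?f) UNIV"
      by (rule has_integral_on_superset) auto
qed

end

section \<open>Decreasing regularisations\<close>

locale subsolution = ellipsoid A B R for A B :: "real^'n^'n" and R :: real +
  fixes X :: "(real^'n) set" and u :: "(real^'n \<Rightarrow> real) \<Rightarrow> real"
  assumes X: "open X" and u: "distribution_on X u"
    and pos: "\<And>\<phi>. \<phi> \<in> test_functions X \<Longrightarrow> (\<And>x. \<phi> x \<ge> 0) \<Longrightarrow> u (elliptic_op A \<phi>) \<ge> 0"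
begin

definition admissible :: "real \<Rightarrow> real^'n \<Rightarrow> bool" where
  "admissible s y \<longleftrightarrow> s > 0 \<and> cball y (R / s) \<subseteq> X"

text \<open>The regularisation of \<open>u\<close> at scale \<open>1 / s\<close>, up to the factor \<open>mass\<close>. The value \<open>V s y\<close> is meaningful
  for admissible \<open>s\<close> only, when the support of the kernel lies in \<open>X\<close>.\<close>

definition V :: "real \<Rightarrow> real^'n \<Rightarrow> real" where
  "V s y = u (kernel s y)"

definition mass :: real where "mass = integral UNIV H"

text \<open>The canonical representative of \<open>u\<close>.\<close>

definition W :: "real^'n \<Rightarrow> ereal" where
  "W y = (INF s\<in>{s. admissible s y}. ereal (V s y / mass))"

lemma admissible_mono:
  assumes "admissible s y" "s \<le> t" shows "admissible t y"
proof -
  have "R / t \<le> R / s" using assms R_pos by (intro divide_left_mono) (auto simp: admissible_def)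
  then have "cball y (R / t) \<subseteq> cball y (R / s)" by auto
  then show ?thesis using assms by (auto simp: admissible_def)
qed

lemma admissible_exists:
  assumes "y \<in> X" obtains s where "admissible s y"
proof -
  obtain e where "e > 0" "cball y e \<subseteq> X" using X assms open_contains_cball by blast
  then have "admissible (R / e) y" using R_pos by (simp add: admissible_def)
  then show thesis by (rule that)
qed

lemma admissible_centre: "admissible s y \<Longrightarrow> y \<in> X"
  using R_pos by (auto simp: admissible_def subset_iff)

lemma kernel_admissible: "admissible s y \<Longrightarrow> kernel s y \<in> test_functions X"
  using kernel_test_function by (simp add: admissible_def)

text \<open>The kernels differ by the operator applied to a non-negative test function.\<close>

lemma V_antimono:
  assumes "admissible s y" "s \<le> t" shows "V t y \<le> V s y"
proof -
  define \<psi> where "\<psi> = superposition (cbox s t) (\<lambda>p. p ^ CARD('n) / p ^ 3) (\<lambda>p. p) (\<lambda>p. y) G"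
  have s: "0 < s" "cball y (R / s) \<subseteq> X" using assms by (auto simp: admissible_def)
  note \<psi> = kernel_diff[OF s(1) assms(2), of y, folded \<psi>_def]
  have "u (elliptic_op A \<psi>) \<ge> 0"
    using pos test_functions_mono[OF \<psi>(3) s(2)] \<psi>(2) by blast
  then show ?thesis
    unfolding \<psi>(1) V_def
    by (simp add: distribution_diff[OF u] kernel_admissible assms admissible_mono[OF assms])
qed

lemma mass_eq: "cball 0 R \<subseteq> cbox l r \<Longrightarrow> mass = integral (cbox l r) H"
proof -
  assume lr: "cball 0 R \<subseteq> cbox l r"
  have "(H has_integral integral (cbox l r) H) UNIV"
  proof (rule has_integral_on_superset)
    show "(H has_integral integral (cbox l r) H) (cbox l r)"
      by (intro integrable_integral integrable_continuous smooth_continuous smooth_GH)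
    show "H x = 0" if "x \<notin> cbox l r" for x
      using GH_eq_0(2)[of x] that lr by (metis mem_cball_0 not_le subsetD)
  qed auto
  then show ?thesis by (simp add: mass_def integral_unique)
qed

lemma mass_pos: "mass > 0"
proof -
  obtain l r where lr: "cball 0 R \<subseteq> cbox l (r :: real^'n)"
    using bounded_subset_cbox_symmetric[OF bounded_cball] by metis
  have "box l r \<noteq> {}"
  proof -
    have "ball 0 R \<subseteq> interior (cbox l r)"
      using lr by (intro interior_maximal) auto
    then show ?thesis using R_pos by (metis centre_in_ball empty_iff interior_cbox subsetD)
  qed
  moreover have "H 0 \<noteq> 0" by (simp add: H_def quad_def flat_def)
  moreover have "0 \<in> cbox l r" using lr R_pos by auto
  ultimately have "integral (cbox l r) H \<noteq> 0"
    using integral_cbox_eq_0_iff[of l r H] smooth_continuous[OF smooth_GH(2)] GH_nonneg(2)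
    by metis
  moreover have "integral (cbox l r) H \<ge> 0"
    by (intro integral_nonneg integrable_continuous smooth_continuous smooth_GH GH_nonneg)
  ultimately show ?thesis using mass_eq[OF lr] by linarith
qed

lemma continuous_V:
  assumes "s > 0" "\<And>y. y \<in> cbox l r \<Longrightarrow> admissible s y"
  shows "continuous_on (cbox l r) (V s)"
proof -
  define K where "K = {x + z |x z. x \<in> cbox l r \<and> z \<in> cball 0 (R / s)}"
  have K: "compact K" unfolding K_def by (intro compact_sums compact_cbox compact_cball)
  have "K \<subseteq> X"
    using assms(2) unfolding K_def admissible_def by (auto simp: subset_iff dist_norm)
  moreover have "kernel s y x = 0" if "y \<in> cbox l r" "x \<notin> K" for x y
  proof (rule affine_copy_GH_eq_0(2)[OF assms(1)])
    have "x = y + (x - y)" by simp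
    then show "x \<notin> cball y (R / s)" using that unfolding K_def by (auto simp: dist_norm norm_minus_commute)
  qed
  ultimately show ?thesis
    unfolding V_def[abs_def] using u K
    by (intro continuous_distribution_copy[where K = K and X = X] smooth_GH continuous_intros) auto
qed

text \<open>Upper semicontinuity of each regularisation, together with the fact that admissibility of a scale is an
  open condition on the centre; both pass to the infimum \<open>W\<close>.\<close>

lemma V_less_nearby:
  assumes "admissible s y" "V s y < a"
  obtains d where "d > 0" "\<And>y'. y' \<in> ball y d \<Longrightarrow> admissible s y'" "\<And>y'. y' \<in> ball y d \<Longrightarrow> V s y' < a"
proof -
  have s: "s > 0" "cball y (R / s) \<subseteq> X" using assms by (auto simp: admissible_def)
  obtain e where e: "e > 0" "(\<Union>x\<in>cball y (R / s). cball x e) \<subseteq> X"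
    using compact_subset_open_imp_cball_epsilon_subset[OF compact_cball X s(2)] by blast
  have adm: "admissible s y'" if "y' \<in> ball y e" for y'
    unfolding admissible_def
  proof (intro conjI subsetI)
    fix z assume "z \<in> cball y' (R / s)"
    then have "z - y' + y \<in> cball y (R / s)" "z \<in> cball (z - y' + y) e"
      using that by (auto simp: dist_norm norm_minus_commute)
    then show "z \<in> X" using e by blast
  qed (rule s)
  obtain l r where lr: "cbox l r \<subseteq> ball y e" "y \<in> box l r"
    using open_contains_cbox[OF open_ball] e(1) by (metis centre_in_ball)
  have "continuous_on (cbox l r) (V s)"
    using lr adm s by (intro continuous_V) auto
  then have "continuous_on (box l r) (V s)"
    by (rule continuous_on_subset) (rule box_subset_cbox)
  then have "open (box l r \<inter> V s -` {..<a})"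
    by (intro continuous_open_preimage) auto
  moreover have "box l r \<inter> V s -` {..<a} = {y' \<in> box l r. V s y' < a}" by auto
  ultimately have "open {y' \<in> box l r. V s y' < a}" by simp
  moreover have "y \<in> {y' \<in> box l r. V s y' < a}" using lr assms by simp
  ultimately obtain d where "d > 0" "ball y d \<subseteq> {y' \<in> box l r. V s y' < a}"
    using open_contains_ball by blast
  then show thesis
    using lr adm box_subset_cbox[of l r] by (intro that[of d]) (auto simp: subset_iff)
qed

text \<open>The real bound \<open>b\<close> between \<open>W\<close> and \<open>a\<close> serves the case \<open>a = \<infinity>\<close> and non-strict estimates of essential
  suprema.\<close>

lemma W_less_nearby:
  assumes "W y < a" "y \<in> X"
  obtains d b where "d > 0" "ball y d \<subseteq> X" "ereal b \<le> a" "\<And>y'. y' \<in> ball y d \<Longrightarrow> W y' < b"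
proof -
  obtain s where s: "admissible s y" "ereal (V s y / mass) < a"
    using assms(1) unfolding W_def INF_less_iff by auto
  obtain b where b: "ereal (V s y / mass) < ereal b" "ereal b < a"
    using ereal_dense2[OF s(2)] by blast
  then have "V s y < b * mass" using mass_pos by (simp add: field_simps)
  from V_less_nearby[OF s(1) this] obtain d where d: "d > 0"
    "\<And>y'. y' \<in> ball y d \<Longrightarrow> admissible s y'" "\<And>y'. y' \<in> ball y d \<Longrightarrow> V s y' < b * mass"
    by blast
  show thesis
  proof (rule that[OF d(1)])
    show "ball y d \<subseteq> X" using d(2) admissible_centre by blast
    show "ereal b \<le> a" using b by simp
    show "W y' < b" if "y' \<in> ball y d" for y'
      unfolding W_def INF_less_iff using d(2,3)[OF that] mass_pos
      by (intro bexI[of _ s]) (auto simp: field_simps)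
  qed
qed

lemma W_limit:
  assumes "y \<in> X" shows "(\<lambda>k. ereal (V (real k) y / mass)) \<longlonglongrightarrow> W y"
proof (rule order_tendstoI)
  fix a assume "a < W y"
  obtain s where s: "admissible s y" using admissible_exists[OF assms] .
  have "a < ereal (V (real k) y / mass)" if "real k \<ge> s" for k
  proof -
    have "W y \<le> ereal (V (real k) y / mass)"
      unfolding W_def using admissible_mono[OF s that] by (intro INF_lower) simp
    then show ?thesis using \<open>a < W y\<close> by (rule less_le_trans[rotated])
  qed
  then show "\<forall>\<^sub>F k in sequentially. a < ereal (V (real k) y / mass)"
    by (rule eventually_mono[OF filterlim_real_sequentially[unfolded filterlim_at_top, rule_format, of s]])
next
  fix a assume "W y < a"
  then obtain s where s: "admissible s y" "ereal (V s y / mass) < a"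
    unfolding W_def INF_less_iff by auto
  have "ereal (V (real k) y / mass) < a" if "real k \<ge> s" for k
  proof -
    have "V (real k) y / mass \<le> V s y / mass"
      using V_antimono[OF s(1) that] mass_pos by (intro divide_right_mono) auto
    then show ?thesis using s(2) by (meson ereal_less_eq(3) le_less_trans)
  qed
  then show "\<forall>\<^sub>F k in sequentially. ereal (V (real k) y / mass) < a"
    by (rule eventually_mono[OF filterlim_real_sequentially[unfolded filterlim_at_top, rule_format, of s]])
qed

text \<open>Both sides are the value of \<open>u\<close> at the convolution of \<open>\<phi>\<close> with a kernel, written once as a
  superposition of kernels and once as a superposition of translates of \<open>\<phi>\<close>.\<close>

lemma pairing_V:
  fixes \<phi> :: "real^'n \<Rightarrow> real"
  assumes \<phi>: "\<phi> \<in> test_functions X" and s: "s > 0"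
    and thick: "(\<Union>x\<in>closure {x. \<phi> x \<noteq> 0}. cball x (R / s)) \<subseteq> X"
    and lr: "cball 0 R \<subseteq> cbox l r"
  shows "integrable lborel (\<lambda>y. \<phi> y * V s y)"
    and "continuous_on (cbox l r) (\<lambda>z. H z * u (affine_copy 1 1 (z /\<^sub>R s) \<phi>))"
    and "(LINT y|lborel. \<phi> y * V s y) = integral (cbox l r) (\<lambda>z. H z * u (affine_copy 1 1 (z /\<^sub>R s) \<phi>))"
proof -
  define S where "S = closure {x. \<phi> x \<noteq> 0}"
  note \<phi>D = test_functionsD[OF \<phi>, folded S_def]
  have S0: "\<phi> x = 0" if "x \<notin> S" for x
    using eq_0_outside_closure that unfolding S_def by blast
  obtain K where K: "compact K" and KX: "K \<subseteq> X"
    and KI: "\<And>x y. y \<in> S \<Longrightarrow> norm (x - y) \<le> R / s \<Longrightarrow> x \<in> K"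
    using thickening[OF \<phi>D(2) thick[folded S_def]] by metis
  obtain l' r' where lr': "S \<subseteq> cbox l' r'"
    using bounded_subset_cbox_symmetric[OF compact_imp_bounded[OF \<phi>D(2)]] by metis
  have vanish1: "affine_copy (\<phi> y * s ^ CARD('n)) s y H x = 0" if "x \<notin> K" for x y
  proof (cases "y \<in> S")
    case True
    then have "x \<notin> cball y (R / s)" using KI[OF True, of x] that by (auto simp: dist_norm norm_minus_commute)
    then show ?thesis by (rule affine_copy_GH_eq_0(2)[OF s])
  qed (simp add: affine_copy_def S0)
  have vanish2: "affine_copy (H z) 1 (z /\<^sub>R s) \<phi> x = 0" if "x \<notin> K" for x z
  proof (cases "norm z \<le> R")
    case True
    have "norm (x - (x - z /\<^sub>R s)) \<le> R / s" using True s by (simp add: field_simps)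
    then have "x - z /\<^sub>R s \<notin> S" using KI that by blast
    then show ?thesis by (simp add: affine_copy_def S0)
  qed (use GH_eq_0(2)[of z] in \<open>simp add: affine_copy_def\<close>)
  have value1: "u (affine_copy (\<phi> y * s ^ CARD('n)) s y H) = \<phi> y * V s y" for y
  proof (cases "y \<in> S")
    case True
    then have "admissible s y" using thick s unfolding admissible_def S_def by blast
    from distribution_cmult[OF u kernel_admissible[OF this], of "\<phi> y"] show ?thesis
      by (simp add: V_def affine_copy_def mult.assoc)
  qed (simp add: affine_copy_def S0 distribution_0[OF u])
  have value2: "u (affine_copy (H z) 1 (z /\<^sub>R s) \<phi>) = H z * u (affine_copy 1 1 (z /\<^sub>R s) \<phi>)" for z
  proof (cases "H z = 0")
    case False
    have "affine_copy 1 1 (z /\<^sub>R s) \<phi> x = 0" if "x \<notin> K" for x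
      using vanish2[OF that, of z] False by (simp add: affine_copy_def)
    then have "affine_copy 1 1 (z /\<^sub>R s) \<phi> \<in> test_functions X"
      by (intro test_functionsI[OF _ K KX] smooth_affine_copy \<phi>D)
    from distribution_cmult[OF u this, of "H z"] show ?thesis
      by (simp add: affine_copy_def)
  qed (simp add: affine_copy_def distribution_0[OF u])
  have c1: "continuous_on (cbox l' r') (\<lambda>y. \<phi> y * s ^ CARD('n))"
    by (intro continuous_intros smooth_continuous \<phi>D)
  have c2: "continuous_on (cbox l r) (\<lambda>z. z /\<^sub>R s)" "continuous_on (cbox l r) H"
    using s by (auto intro!: continuous_intros smooth_continuous smooth_GH)
  have cont1: "continuous_on (cbox l' r') (\<lambda>y. \<phi> y * V s y)"
    using continuous_distribution_copy[OF continuous_on_const continuous_on_id c1 smooth_GH(2) u K KX vanish1]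
    by (simp add: value1)
  have "integrable lborel (\<lambda>y. indicator (cbox l' r') y *\<^sub>R (\<phi> y * V s y))"
    by (intro borel_integrable_compact cont1 compact_cbox)
  moreover have "(\<lambda>y. indicator (cbox l' r') y *\<^sub>R (\<phi> y * V s y)) = (\<lambda>y. \<phi> y * V s y)"
    using lr' S0 by (auto simp: fun_eq_iff indicator_def)
  ultimately show int: "integrable lborel (\<lambda>y. \<phi> y * V s y)" by simp
  show "continuous_on (cbox l r) (\<lambda>z. H z * u (affine_copy 1 1 (z /\<^sub>R s) \<phi>))"
    using continuous_distribution_copy[OF continuous_on_const c2 \<phi>D(1) u K KX vanish2]
    by (simp add: value2)
  have cut: "integral UNIV f = integral (cbox l' r') f" if "\<And>y. y \<notin> S \<Longrightarrow> f y = 0" for f :: "real^'n \<Rightarrow> real"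
  proof -
    have "(\<lambda>y. if y \<in> cbox l' r' then f y else 0) = f" using that lr' by (auto simp: fun_eq_iff)
    then show ?thesis using Henstock_Kurzweil_Integration.integral_restrict_UNIV[of "cbox l' r'" f] by simp
  qed
  have "(LINT y|lborel. \<phi> y * V s y) = integral UNIV (\<lambda>y. \<phi> y * V s y)"
    using has_integral_integral_lborel[OF int] by (simp add: integral_unique)
  also have "\<dots> = integral (cbox l' r') (\<lambda>y. \<phi> y * V s y)"
    by (rule cut) (simp add: S0)
  also have "\<dots> = u (superposition (cbox l' r') (\<lambda>y. \<phi> y * s ^ CARD('n)) (\<lambda>y. s) (\<lambda>y. y) H)"
    using distribution_superposition[OF continuous_on_const continuous_on_id c1 smooth_GH(2) u K KX vanish1]
    by (simp add: value1)
  also have "superposition (cbox l' r') (\<lambda>y. \<phi> y * s ^ CARD('n)) (\<lambda>y. s) (\<lambda>y. y) H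
      = superposition (cbox l r) H (\<lambda>z. 1) (\<lambda>z. z /\<^sub>R s) \<phi>"
  proof
    fix x
    have "superposition (cbox l' r') (\<lambda>y. \<phi> y * s ^ CARD('n)) (\<lambda>y. s) (\<lambda>y. y) H x
        = integral (cbox l' r') (\<lambda>y. \<phi> y * kernel s y x)"
      by (simp add: superposition_def affine_copy_def mult.assoc)
    also have "\<dots> = integral UNIV (\<lambda>y. \<phi> y * kernel s y x)"
      by (rule cut[symmetric]) (simp add: S0)
    also have "\<dots> = integral (cbox l r) (\<lambda>z. H z * \<phi> (x - z /\<^sub>R s))"
      by (rule integral_unique[OF kernel_has_integral[OF s \<phi>D(1) lr]])
    finally show "superposition (cbox l' r') (\<lambda>y. \<phi> y * s ^ CARD('n)) (\<lambda>y. s) (\<lambda>y. y) H x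
        = superposition (cbox l r) H (\<lambda>z. 1) (\<lambda>z. z /\<^sub>R s) \<phi> x"
      by (simp add: superposition_def affine_copy_def)
  qed
  also have "u \<dots> = integral (cbox l r) (\<lambda>z. H z * u (affine_copy 1 1 (z /\<^sub>R s) \<phi>))"
    using distribution_superposition[OF continuous_on_const c2 \<phi>D(1) u K KX vanish2]
    by (simp add: value2)
  finally show "(LINT y|lborel. \<phi> y * V s y) = integral (cbox l r) (\<lambda>z. H z * u (affine_copy 1 1 (z /\<^sub>R s) \<phi>))" .
qed

end

section \<open>Cutoff functions and locally integrable functions\<close>

lemma smooth_bump:
  fixes y :: "real^'n"
  shows "smooth (\<lambda>x. flat 0 (d\<^sup>2 - (norm (x - y))\<^sup>2))"
proof -
  have "smooth (\<lambda>x::real^'n. x $ i)" for i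
    by (rule smooth_bounded_linear) (rule bounded_linear_vec_nth)
  then have "smooth (\<lambda>x. d\<^sup>2 - (\<Sum>i\<in>UNIV. (x $ i - y $ i) * (x $ i - y $ i)))"
    by (intro smooth_diff smooth_const smooth_sum smooth_mult)
  also have "(\<lambda>x. \<Sum>i\<in>UNIV. (x $ i - y $ i) * (x $ i - y $ i)) = (\<lambda>x. (norm (x - y))\<^sup>2)"
    by (simp add: fun_eq_iff power2_norm_eq_inner inner_vec_def)
  finally show ?thesis
    using smooth_flat_compose by (metis (no_types))
qed

text \<open>Finitely many bumps centred in \<open>K\<close> cover \<open>K\<close>; their sum is bounded below on \<open>K\<close> by a positive constant,
  by which it is divided.\<close>

lemma test_function_ge_1:
  fixes K X :: "(real^'n) set"
  assumes "compact K" "open X" "K \<subseteq> X"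
  obtains \<eta> where "\<eta> \<in> test_functions X" "\<And>x. \<eta> x \<ge> 0" "\<And>x. x \<in> K \<Longrightarrow> \<eta> x \<ge> 1"
proof (cases "K = {}")
  case True
  then show ?thesis using that[OF test_functions_0] by simp
next
  case False
  obtain e where e: "e > 0" "(\<Union>x\<in>K. cball x e) \<subseteq> X"
    using compact_subset_open_imp_cball_epsilon_subset[OF assms] by blast
  obtain K' where K': "compact K'" "K' \<subseteq> X" "\<And>x y. y \<in> K \<Longrightarrow> norm (x - y) \<le> e \<Longrightarrow> x \<in> K'"
    using thickening[OF assms(1) e(2)] by metis
  obtain F where F: "F \<subseteq> K" "finite F" "K \<subseteq> (\<Union>y\<in>F. ball y e)"
  proof (rule compactE_image[OF assms(1), of K "\<lambda>y. ball y e"])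
    show "K \<subseteq> (\<Union>y\<in>K. ball y e)" using e(1) by auto
  qed auto
  define P where "P x = (\<Sum>y\<in>F. flat 0 (e\<^sup>2 - (norm (x - y))\<^sup>2))" for x
  have smooth_P: "smooth P"
    unfolding P_def[abs_def] by (intro smooth_sum smooth_bump)
  have P_nonneg: "P x \<ge> 0" for x
    unfolding P_def by (intro sum_nonneg flat_nonneg)
  have P_pos: "P x > 0" if "x \<in> K" for x
  proof -
    obtain y where y: "y \<in> F" "norm (x - y) < e"
      using F(3) \<open>x \<in> K\<close> by (auto simp: dist_norm norm_minus_commute)
    then have "(norm (x - y))\<^sup>2 < e\<^sup>2" by (intro power_strict_mono) auto
    then show ?thesis unfolding P_def
      by (intro sum_pos2[OF F(2) y(1)]) (simp_all add: flat_pos_iff flat_nonneg)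
  qed
  have P_zero: "P x = 0" if "x \<notin> K'" for x
    unfolding P_def
  proof (rule sum.neutral, intro ballI)
    fix y assume "y \<in> F"
    then have "norm (x - y) > e" using K'(3)[of y x] F(1) that by force
    then have "e\<^sup>2 < (norm (x - y))\<^sup>2" using e(1) by (intro power_strict_mono) auto
    then show "flat 0 (e\<^sup>2 - (norm (x - y))\<^sup>2) = 0" by (simp add: flat_def)
  qed
  obtain x0 where x0: "x0 \<in> K" "\<And>x. x \<in> K \<Longrightarrow> P x0 \<le> P x"
    using continuous_attains_inf[OF assms(1) False smooth_continuous[OF smooth_P]] by blast
  show thesis
  proof (rule that[of "\<lambda>x. (1 / P x0) * P x"])
    show "(\<lambda>x. (1 / P x0) * P x) \<in> test_functions X"
      by (rule test_functionsI[OF smooth_mult[OF smooth_const smooth_P] K'(1,2)]) (simp add: P_zero)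
    show "(1 / P x0) * P x \<ge> 0" for x using P_nonneg by simp
    show "(1 / P x0) * P x \<ge> 1" if "x \<in> K" for x
      using x0(2)[OF that] P_pos[OF x0(1)] by simp
  qed
qed

lemma L1_loc_integrable_on_compact:
  assumes "f \<in> L1_loc X" "compact K" "K \<subseteq> X"
  shows "integrable lebesgue (\<lambda>x. indicator K x * f x)"
  using assms by (simp add: L1_loc_def set_integrable_def)

lemma L1_loc_mult_compact_support:
  assumes f: "f \<in> L1_loc X" and K: "compact K" "K \<subseteq> X"
    and g: "continuous_on UNIV g" "\<And>x. x \<notin> K \<Longrightarrow> g x = 0"
  shows "integrable lebesgue (\<lambda>x. f x * g x)"
proof -
  have "bounded (g ` K)"
    by (intro compact_imp_bounded compact_continuous_image continuous_on_subset[OF g(1)] K) auto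
  then obtain M where "\<And>x. x \<in> K \<Longrightarrow> \<bar>g x\<bar> \<le> M"
    unfolding bounded_iff by auto
  then have M: "\<bar>g x\<bar> \<le> \<bar>M\<bar>" for x
    using g(2)[of x] by (cases "x \<in> K") force+
  have g_meas: "g \<in> borel_measurable lebesgue"
    using borel_measurable_continuous_onI[OF g(1)] by (simp add: measurable_completion)
  have int: "integrable lebesgue (\<lambda>x. \<bar>M\<bar> * (indicator K x * f x))"
    using L1_loc_integrable_on_compact[OF f K] by simp
  have eq: "(\<lambda>x. f x * g x) = (\<lambda>x. (indicator K x * f x) * g x)"
    using g(2) by (auto simp: fun_eq_iff indicator_def)
  show ?thesis
    unfolding eq
  proof (rule Bochner_Integration.integrable_bound[OF int])
    show "(\<lambda>x. indicator K x * f x * g x) \<in> borel_measurable lebesgue"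
      by (intro borel_measurable_times[OF borel_measurable_integrable g_meas] L1_loc_integrable_on_compact[OF f K])
    show "AE x in lebesgue. norm (indicator K x * f x * g x) \<le> norm (\<bar>M\<bar> * (indicator K x * f x))"
      using M by (intro AE_I2) (simp add: abs_mult mult.commute mult_right_mono)
  qed
qed

lemma L1_loc_mult_test:
  assumes "f \<in> L1_loc X" "\<phi> \<in> test_functions X"
  shows "integrable lebesgue (\<lambda>x. f x * \<phi> x)"
  using test_functionsD[OF assms(2)] eq_0_outside_closure
  by (intro L1_loc_mult_compact_support[OF assms(1)] smooth_continuous) blast+

lemma lebesgue_on_test:
  assumes "open X" "\<phi> \<in> test_functions X"
  shows "(LINT x|lebesgue_on X. f x * \<phi> x) = (LINT x|lebesgue. f x * \<phi> x)"
proof -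
  have "X \<in> sets lebesgue" using assms(1) by simp
  then have "(LINT x|lebesgue_on X. f x * \<phi> x) = (LINT x|lebesgue. indicator X x *\<^sub>R (f x * \<phi> x))"
    by (intro integral_restrict_space) simp
  also have "(\<lambda>x. indicator X x *\<^sub>R (f x * \<phi> x)) = (\<lambda>x. f x * \<phi> x)"
    using test_functions_eq_0[OF assms(2)] by (auto simp: fun_eq_iff indicator_def)
  finally show ?thesis .
qed

lemma compact_exhaustion:
  fixes X :: "'a::euclidean_space set"
  assumes "open X"
  obtains C :: "nat \<Rightarrow> 'a set" where "\<And>n. compact (C n)" "\<And>n. C n \<subseteq> X"
    "\<And>x. x \<in> X \<Longrightarrow> \<exists>N. \<forall>n\<ge>N. x \<in> C n"
proof (rule open_Union_compact_subsets[OF assms])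
  fix C :: "nat \<Rightarrow> 'a set"
  assume C: "\<And>n. compact (C n)" "\<And>n. C n \<subseteq> X"
    and sub: "\<And>K. \<lbrakk>compact K; K \<subseteq> X\<rbrakk> \<Longrightarrow> \<exists>N. \<forall>n\<ge>N. K \<subseteq> C n"
  have "\<exists>N. \<forall>n\<ge>N. x \<in> C n" if "x \<in> X" for x
    using sub[of "{x}"] that by simp
  with C show thesis by (rule that)
qed

lemma L1_loc_measurable:
  fixes f :: "real^'n \<Rightarrow> real"
  assumes "f \<in> L1_loc X" "open X"
  shows "f \<in> borel_measurable (lebesgue_on X)"
proof -
  obtain C :: "nat \<Rightarrow> (real^'n) set" where C: "\<And>n. compact (C n)" "\<And>n. C n \<subseteq> X"
    "\<And>x. x \<in> X \<Longrightarrow> \<exists>N. \<forall>n\<ge>N. x \<in> C n"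
    using compact_exhaustion[OF assms(2)] by metis
  have "(\<lambda>n. indicator (C n) x * f x) \<longlonglongrightarrow> indicator X x * f x" for x
  proof (rule tendsto_mult_right, rule tendsto_eventually, cases "x \<in> X")
    case True
    with C(3) show "\<forall>\<^sub>F n in sequentially. indicator (C n) x = indicator X x"
      unfolding eventually_sequentially by (auto simp: indicator_def)
  next
    case False
    then show "\<forall>\<^sub>F n in sequentially. indicator (C n) x = indicator X x"
      using C(2) by (intro always_eventually) (auto simp: indicator_def)
  qed
  then have "(\<lambda>x. indicator X x * f x) \<in> borel_measurable lebesgue"
    by (rule borel_measurable_LIMSEQ_real)
      (rule borel_measurable_integrable[OF L1_loc_integrable_on_compact[OF assms(1) C(1,2)]])
  then show ?thesis
    using assms(2) by (subst borel_measurable_restrict_space_iff) auto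
qed

text \<open>Dominated convergence: the indicator of a compact set is a bounded pointwise limit of test functions whose
  supports lie in a fixed compact subset of \<open>X\<close>.\<close>

lemma integral_over_compact_eq_0:
  fixes g :: "real^'n \<Rightarrow> real"
  assumes g: "g \<in> L1_loc X" and X: "open X"
    and zero: "\<And>\<phi>. \<phi> \<in> test_functions X \<Longrightarrow> (LINT x|lebesgue. g x * \<phi> x) = 0"
    and K: "compact K" "K \<subseteq> X"
  shows "(LINT x|lebesgue. indicator K x * g x) = 0"
proof -
  obtain e where e: "e > 0" "(\<Union>x\<in>K. cball x e) \<subseteq> X"
    using compact_subset_open_imp_cball_epsilon_subset[OF K(1) X K(2)] by blast
  obtain K' where K': "compact K'" "K' \<subseteq> X" "\<And>x y. y \<in> K \<Longrightarrow> norm (x - y) \<le> e \<Longrightarrow> x \<in> K'"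
    using thickening[OF K(1) e(2)] by metis
  define U where "U n = (\<Union>y\<in>K. ball y (e / Suc n))" for n
  have "\<exists>\<eta>. \<eta> \<in> test_functions (U n) \<and> (\<forall>x. \<eta> x \<ge> 0) \<and> (\<forall>x\<in>K. \<eta> x \<ge> 1)" for n
  proof -
    have "open (U n)" "K \<subseteq> U n" using e(1) unfolding U_def by auto
    then show ?thesis using test_function_ge_1[OF K(1)] by metis
  qed
  then obtain \<eta> where \<eta>: "\<And>n. \<eta> n \<in> test_functions (U n)" "\<And>n x. \<eta> n x \<ge> 0"
    "\<And>n x. x \<in> K \<Longrightarrow> \<eta> n x \<ge> 1"
    by metis
  \<comment> \<open>\<open>flat 0\<close> maps into \<open>[0, 1]\<close>, vanishes at \<open>0\<close> and tends to \<open>1\<close> at infinity: it turns the bumps \<open>\<eta> n\<close> into cutoffs\<close>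
  define \<phi> where "\<phi> n x = flat 0 (real (Suc n) * \<eta> n x)" for n x
  have U_K': "U n \<subseteq> K'" for n
  proof
    fix x assume "x \<in> U n"
    then obtain y where y: "y \<in> K" "norm (x - y) < e / Suc n"
      by (auto simp: U_def dist_norm norm_minus_commute)
    have "e / Suc n \<le> e" using e(1) by (simp add: field_simps)
    then show "x \<in> K'" using K'(3) y by (meson less_eq_real_def less_le_trans)
  qed
  have \<phi>_0: "\<phi> n x = 0" if "x \<notin> U n" for n x
    using test_functions_eq_0[OF \<eta>(1) that] by (simp add: \<phi>_def flat_def)
  have \<phi>_smooth: "smooth (\<phi> n)" for n
    unfolding \<phi>_def[abs_def] by (intro smooth_flat_compose smooth_mult smooth_const test_functionsD(1)[OF \<eta>(1)])
  have \<phi>_test: "\<phi> n \<in> test_functions X" for n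
    using \<phi>_0 U_K' by (intro test_functionsI[OF \<phi>_smooth K'(1,2)]) blast
  have lim: "(\<lambda>n. \<phi> n x) \<longlonglongrightarrow> indicator K x" for x
  proof (cases "x \<in> K")
    case True
    have "(\<lambda>n. exp (- inverse (real (Suc n)))) \<longlonglongrightarrow> exp (- 0)"
      by (intro tendsto_intros LIMSEQ_inverse_real_of_nat)
    then have lower_lim: "(\<lambda>n. exp (- inverse (real (Suc n)))) \<longlonglongrightarrow> 1" by simp
    have lower: "exp (- inverse (real (Suc n))) \<le> \<phi> n x" for n
    proof -
      have "1 \<le> \<eta> n x" using \<eta>(3) True by blast
      then have "real (Suc n) * 1 \<le> real (Suc n) * \<eta> n x" by (intro mult_left_mono) auto
      then have "inverse (real (Suc n) * \<eta> n x) \<le> inverse (real (Suc n))"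
        by (intro le_imp_inverse_le) auto
      then show ?thesis
        using \<open>1 \<le> \<eta> n x\<close> by (simp add: \<phi>_def flat_def divide_inverse)
    qed
    have "(\<lambda>n. \<phi> n x) \<longlonglongrightarrow> 1"
    proof (rule tendsto_sandwich[OF _ _ lower_lim tendsto_const])
      show "\<forall>\<^sub>F n in sequentially. exp (- inverse (real (Suc n))) \<le> \<phi> n x"
        by (rule always_eventually) (intro allI lower)
      show "\<forall>\<^sub>F n in sequentially. \<phi> n x \<le> 1"
        unfolding \<phi>_def by (rule always_eventually) (intro allI flat_0_le_1)
    qed
    then show ?thesis using True by simp
  next
    case False
    have "closed K" using K(1) by (rule compact_imp_closed)
    then have "open (- K)" by (rule open_Compl)
    then obtain d where d: "d > 0" "ball x d \<subseteq> - K"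
      using False open_contains_ball by (metis ComplI)
    have "(\<lambda>n. e * inverse (real (Suc n))) \<longlonglongrightarrow> e * 0"
      by (intro tendsto_intros LIMSEQ_inverse_real_of_nat)
    then have "\<forall>\<^sub>F n in sequentially. e * inverse (real (Suc n)) < d"
      using d(1) by (intro order_tendstoD(2)[of _ 0]) auto
    then have "\<forall>\<^sub>F n in sequentially. \<phi> n x = indicator K x"
    proof (rule eventually_mono)
      fix n assume n: "e * inverse (real (Suc n)) < d"
      have "x \<notin> U n"
      proof
        assume "x \<in> U n"
        then obtain y where y: "y \<in> K" "dist y x < e / Suc n" by (auto simp: U_def)
        then have "y \<in> ball x d" using n by (simp add: dist_commute divide_inverse)
        then show False using d(2) y(1) by blast
      qed
      then show "\<phi> n x = indicator K x" using \<phi>_0 False by simp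
    qed
    then show ?thesis by (rule tendsto_eventually)
  qed
  have int_K': "integrable lebesgue (\<lambda>x. indicator K' x * g x)"
    by (rule L1_loc_integrable_on_compact[OF g K'(1,2)])
  have "(\<lambda>n. LINT x|lebesgue. g x * \<phi> n x) \<longlonglongrightarrow> (LINT x|lebesgue. indicator K x * g x)"
  proof (rule integral_dominated_convergence)
    show "integrable lebesgue (\<lambda>x. \<bar>indicator K' x * g x\<bar>)"
      using int_K' by (rule integrable_abs)
    show "(\<lambda>x. indicator K x * g x) \<in> borel_measurable lebesgue"
      using L1_loc_integrable_on_compact[OF g K] by (rule borel_measurable_integrable)
    show "(\<lambda>x. g x * \<phi> n x) \<in> borel_measurable lebesgue" for n
      using L1_loc_mult_test[OF g \<phi>_test] by (rule borel_measurable_integrable)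
    show "AE x in lebesgue. (\<lambda>n. g x * \<phi> n x) \<longlonglongrightarrow> indicator K x * g x"
      using tendsto_mult_left[OF lim] by (intro AE_I2) (simp add: mult.commute)
    show "AE x in lebesgue. norm (g x * \<phi> n x) \<le> \<bar>indicator K' x * g x\<bar>" for n
    proof (intro AE_I2)
      fix x
      show "norm (g x * \<phi> n x) \<le> \<bar>indicator K' x * g x\<bar>"
      proof (cases "x \<in> K'")
        case True
        have "\<bar>\<phi> n x\<bar> \<le> 1" by (simp add: \<phi>_def flat_nonneg flat_0_le_1)
        then show ?thesis using True by (simp add: abs_mult mult_left_le)
      next
        case False
        then show ?thesis using \<phi>_0 U_K' by (metis abs_ge_zero mult_zero_right norm_zero subsetD)
      qed
    qed
  qed
  moreover have "(\<lambda>n. LINT x|lebesgue. g x * \<phi> n x) = (\<lambda>n. 0)"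
    using zero[OF \<phi>_test] by simp
  ultimately show ?thesis using LIMSEQ_unique tendsto_const by metis
qed

text \<open>Inner regularity: the set is exhausted up to measure \<open>e\<close> by a closed set, and a closed set by compact ones.\<close>

lemma null_set_of_compact_null:
  fixes S :: "(real^'n) set"
  assumes S: "S \<in> sets lebesgue" and null: "\<And>C. compact C \<Longrightarrow> C \<subseteq> S \<Longrightarrow> C \<in> null_sets lebesgue"
  shows "S \<in> null_sets lebesgue"
proof -
  have "emeasure lebesgue S \<le> ennreal e" if "e > 0" for e
  proof -
    obtain T where T: "closed T" "T \<subseteq> S" "S - T \<in> lmeasurable" "emeasure lebesgue (S - T) < ennreal e"
      using sets_lebesgue_inner_closed[OF S \<open>e > 0\<close>] .
    have "T = (\<Union>n::nat. T \<inter> cball 0 (real n))"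
      using real_arch_simple by (auto simp: dist_norm)
    moreover have "(\<Union>n::nat. T \<inter> cball 0 (real n)) \<in> null_sets lebesgue"
      using T(1,2) by (intro null_sets_UN null closed_Int_compact compact_cball) auto
    ultimately have "T \<in> null_sets lebesgue" by simp
    then have "emeasure lebesgue (S - T) = emeasure lebesgue S"
      using S by (intro emeasure_Diff_null_set) auto
    then show ?thesis using T(4) by simp
  qed
  then have "emeasure lebesgue S = 0"
    by (metis ennreal_le_epsilon add_0 le_zero_eq)
  then show ?thesis using S by (intro null_setsI)
qed

text \<open>The fundamental lemma of the calculus of variations. On a compact subset of \<open>{x \<in> X. g x > 0}\<close> the integral
  of the positive function \<open>g\<close> vanishes, so the subset is null; the same holds for \<open>- g\<close>.\<close>

lemma fundamental_lemma:
  fixes g :: "real^'n \<Rightarrow> real"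
  assumes g: "g \<in> L1_loc X" and X: "open X"
    and zero: "\<And>\<phi>. \<phi> \<in> test_functions X \<Longrightarrow> (LINT x|lebesgue. g x * \<phi> x) = 0"
  shows "AE x in lebesgue. x \<in> X \<longrightarrow> g x = 0"
proof -
  have null: "{x \<in> X. s * g x > 0} \<in> null_sets lebesgue" for s :: real
  proof (rule null_set_of_compact_null)
    have "{x \<in> space (lebesgue_on X). s * g x > 0} \<in> sets (lebesgue_on X)"
      using L1_loc_measurable[OF g X] by measurable
    then show "{x \<in> X. s * g x > 0} \<in> sets lebesgue"
      using X by (simp add: sets_restrict_space_iff)
    fix C assume C: "compact C" "C \<subseteq> {x \<in> X. s * g x > 0}"
    then have CX: "C \<subseteq> X" by blast
    have int: "integrable lebesgue (\<lambda>x. s * (indicator C x * g x))"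
      using L1_loc_integrable_on_compact[OF g C(1) CX] by simp
    have "(LINT x|lebesgue. s * (indicator C x * g x)) = 0"
      using integral_over_compact_eq_0[OF g X zero C(1) CX] by simp
    moreover have "AE x in lebesgue. 0 \<le> s * (indicator C x * g x)"
      using C(2) by (intro AE_I2) (force simp: indicator_def)
    ultimately have "AE x in lebesgue. s * (indicator C x * g x) = 0"
      using integral_nonneg_eq_0_iff_AE[OF int] by simp
    then have "AE x in lebesgue. x \<notin> C"
      by eventually_elim (use C(2) in \<open>force simp: indicator_def\<close>)
    then show "C \<in> null_sets lebesgue"
      using AE_iff_null_sets[of C lebesgue] fmeasurableD[OF lmeasurable_compact[OF C(1)]] by simp
  qed
  have "AE x in lebesgue. x \<notin> {x \<in> X. 1 * g x > 0}" "AE x in lebesgue. x \<notin> {x \<in> X. (-1) * g x > 0}"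
    by (rule AE_not_in[OF null])+
  then show ?thesis by eventually_elim force
qed

context subsolution
begin

lemma eventually_thick:
  assumes "\<phi> \<in> test_functions X"
  obtains k0 :: nat where "k0 > 0"
    "\<And>k. k \<ge> k0 \<Longrightarrow> (\<Union>x\<in>closure {x. \<phi> x \<noteq> 0}. cball x (R / real k)) \<subseteq> X"
    "\<And>k y. k \<ge> k0 \<Longrightarrow> \<phi> y \<noteq> 0 \<Longrightarrow> admissible (real k) y"
proof -
  define S where "S = closure {x. \<phi> x \<noteq> 0}"
  obtain e where e: "e > 0" "(\<Union>x\<in>S. cball x e) \<subseteq> X"
    using compact_subset_open_imp_cball_epsilon_subset[OF test_functionsD(2)[OF assms] X test_functionsD(3)[OF assms]]
    unfolding S_def by blast
  define k0 where "k0 = nat \<lceil>R / e\<rceil> + 1"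
  have thick: "(\<Union>x\<in>S. cball x (R / real k)) \<subseteq> X" if "k \<ge> k0" for k
  proof -
    have "real k \<ge> R / e" "real k > 0" using that by (auto simp: k0_def) linarith
    then have "R / real k \<le> e" using e(1) by (simp add: field_simps)
    then have "cball x (R / real k) \<subseteq> cball x e" for x by auto
    then show ?thesis using e(2) by blast
  qed
  have S: "y \<in> S" if "\<phi> y \<noteq> 0" for y
    using that eq_0_outside_closure unfolding S_def by blast
  show thesis
  proof (rule that[of k0])
    show "k0 > 0" by (simp add: k0_def)
    show "(\<Union>x\<in>closure {x. \<phi> x \<noteq> 0}. cball x (R / real k)) \<subseteq> X" if "k \<ge> k0" for k
      using thick[OF that] by (simp only: S_def)
    show "admissible (real k) y" if "k \<ge> k0" "\<phi> y \<noteq> 0" for k y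
      unfolding admissible_def
    proof
      show "real k > 0" using that(1) by (simp add: k0_def)
      show "cball y (R / real k) \<subseteq> X" using thick[OF that(1)] S[OF that(2)] by blast
    qed
  qed
qed

text \<open>In the second form of \<open>pairing_V\<close> the translates of \<open>\<phi>\<close> by \<open>z /\<^sub>R s\<close> with \<open>z\<close> in the support of \<open>H\<close> approach
  \<open>\<phi>\<close>, uniformly in \<open>z\<close>, and \<open>u\<close> depends continuously on the translation.\<close>

lemma pairing_limit:
  assumes \<phi>: "\<phi> \<in> test_functions X"
  shows "(\<lambda>k. LINT y|lborel. \<phi> y * V (real k) y) \<longlonglongrightarrow> mass * u \<phi>"
proof -
  define S where "S = closure {x. \<phi> x \<noteq> 0}"
  note \<phi>D = test_functionsD[OF \<phi>, folded S_def]
  have S0: "\<phi> x = 0" if "x \<notin> S" for x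
    using eq_0_outside_closure that unfolding S_def by blast
  obtain k0 where k0: "k0 > 0" "\<And>k. k \<ge> k0 \<Longrightarrow> (\<Union>x\<in>S. cball x (R / real k)) \<subseteq> X"
    using eventually_thick[OF \<phi>] unfolding S_def by metis
  define e where "e = R / real k0"
  have "e > 0" using R_pos k0(1) by (simp add: e_def)
  obtain K where K: "compact K" "K \<subseteq> X" "\<And>x y. y \<in> S \<Longrightarrow> norm (x - y) \<le> e \<Longrightarrow> x \<in> K"
    using thickening[OF \<phi>D(2) k0(2)[OF order_refl, folded e_def]] by metis
  obtain l r where lr: "cball 0 R \<subseteq> cbox l (r :: real^'n)"
    using bounded_subset_cbox_symmetric[OF bounded_cball] by metis
  obtain l' r' where lr': "cbox l' r' \<subseteq> ball 0 e" "(0 :: real^'n) \<in> box l' r'"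
    using open_contains_cbox[OF open_ball] \<open>e > 0\<close> by (metis centre_in_ball)
  have "affine_copy 1 1 b \<phi> x = 0" if "b \<in> cbox l' r'" "x \<notin> K" for b x
  proof -
    have "norm (x - (x - b)) \<le> e" using lr'(1) that(1) by (auto simp: dist_norm)
    then have "x - b \<notin> S" using K(3) that(2) by blast
    then show ?thesis by (simp add: affine_copy_def S0)
  qed
  then have cont: "continuous_on (cbox l' r') (\<lambda>b. u (affine_copy 1 1 b \<phi>))"
    using K by (intro continuous_distribution_copy[where K = K and X = X] \<phi>D(1) u continuous_intros) auto
  have copy_0: "affine_copy 1 1 0 \<phi> = \<phi>" by (simp add: affine_copy_def)
  obtain \<rho> where \<rho>: "\<rho> > 0" "ball 0 \<rho> \<subseteq> cbox l' r'"
    using open_box[of l' r'] lr'(2) box_subset_cbox[of l' r'] unfolding open_contains_ball by blast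
  show ?thesis
  proof (rule LIMSEQ_I)
    fix \<eta> :: real assume "\<eta> > 0"
    define \<epsilon> where "\<epsilon> = \<eta> / (2 * mass)"
    have "\<epsilon> > 0" using \<open>\<eta> > 0\<close> mass_pos by (simp add: \<epsilon>_def)
    moreover have "0 \<in> cbox l' r'" using lr'(2) box_subset_cbox by blast
    ultimately obtain d where d: "d > 0"
      "\<And>b. b \<in> cbox l' r' \<Longrightarrow> dist b 0 < d \<Longrightarrow> dist (u (affine_copy 1 1 b \<phi>)) (u (affine_copy 1 1 0 \<phi>)) < \<epsilon>"
      using cont unfolding continuous_on_iff by metis
    obtain k1 :: nat where k1: "R / min d \<rho> < real k1" using reals_Archimedean2 by blast
    have "norm ((LINT y|lborel. \<phi> y * V (real k) y) - mass * u \<phi>) < \<eta>" if k: "k \<ge> max k0 k1" for k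
    proof -
      have "real k > 0" using k k0(1) by simp
      have thick: "(\<Union>x\<in>closure {x. \<phi> x \<noteq> 0}. cball x (R / real k)) \<subseteq> X"
        using k0(2) k unfolding S_def by simp
      note pair = pairing_V[OF \<phi> \<open>real k > 0\<close> thick lr]
      have small: "R / real k < min d \<rho>"
      proof -
        have "R / min d \<rho> < real k" using k1 k by linarith
        moreover have "min d \<rho> > 0" using d(1) \<rho>(1) by simp
        ultimately show ?thesis
          using \<open>real k > 0\<close> by (metis mult.commute pos_divide_less_eq)
      qed
      have le: "norm (H z * (u (affine_copy 1 1 (z /\<^sub>R real k) \<phi>) - u \<phi>)) \<le> H z * \<epsilon>" for z
      proof (cases "norm z \<le> R")
        case True
        then have "norm (z /\<^sub>R real k) \<le> R / real k"
          using \<open>real k > 0\<close> by (simp add: field_simps)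
        then have "norm (z /\<^sub>R real k) < min d \<rho>" using small by linarith
        then have "z /\<^sub>R real k \<in> cbox l' r'" "dist (z /\<^sub>R real k) 0 < d" using \<rho>(2) by auto
        then have "\<bar>u (affine_copy 1 1 (z /\<^sub>R real k) \<phi>) - u \<phi>\<bar> \<le> \<epsilon>"
          using d(2) copy_0 by (fastforce simp: dist_real_def)
        then show ?thesis
          using GH_nonneg(2)[of z] by (simp add: abs_mult mult_left_mono)
      qed (use GH_eq_0(2)[of z] in simp)
      have H_cont: "continuous_on (cbox l r) H" by (intro smooth_continuous smooth_GH)
      have eq: "(LINT y|lborel. \<phi> y * V (real k) y) - mass * u \<phi>
          = integral (cbox l r) (\<lambda>z. H z * (u (affine_copy 1 1 (z /\<^sub>R real k) \<phi>) - u \<phi>))"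
      proof -
        have "integral (cbox l r) (\<lambda>z. H z * u (affine_copy 1 1 (z /\<^sub>R real k) \<phi>)) - integral (cbox l r) (\<lambda>z. H z * u \<phi>)
          = integral (cbox l r) (\<lambda>z. H z * u (affine_copy 1 1 (z /\<^sub>R real k) \<phi>) - H z * u \<phi>)"
          by (intro integral_diff[symmetric] integrable_continuous pair(2) continuous_intros H_cont)
        moreover have "integral (cbox l r) (\<lambda>z. H z * u \<phi>) = mass * u \<phi>"
          using mass_eq[OF lr] by simp
        ultimately show ?thesis unfolding pair(3) right_diff_distrib by linarith
      qed
      have "continuous_on (cbox l r) (\<lambda>z. H z * u (affine_copy 1 1 (z /\<^sub>R real k) \<phi>) - H z * u \<phi>)"
        by (intro continuous_intros pair(2) H_cont)
      then have "continuous_on (cbox l r) (\<lambda>z. H z * (u (affine_copy 1 1 (z /\<^sub>R real k) \<phi>) - u \<phi>))"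
        by (simp add: right_diff_distrib)
      then have "norm (integral (cbox l r) (\<lambda>z. H z * (u (affine_copy 1 1 (z /\<^sub>R real k) \<phi>) - u \<phi>)))
          \<le> integral (cbox l r) (\<lambda>z. H z * \<epsilon>)"
        by (intro Henstock_Kurzweil_Integration.integral_norm_bound_integral le
            integrable_continuous[OF continuous_on_mult[OF H_cont continuous_on_const]])
          (rule integrable_continuous)
      also have "integral (cbox l r) (\<lambda>z. H z * \<epsilon>) = mass * \<epsilon>"
        using mass_eq[OF lr] by simp
      also have "mass * \<epsilon> < \<eta>"
        using mass_pos \<open>\<eta> > 0\<close> by (simp add: \<epsilon>_def)
      finally show ?thesis unfolding eq .
    qed
    then show "\<exists>no. \<forall>n\<ge>no. norm ((LINT y|lborel. \<phi> y * V (real n) y) - mass * u \<phi>) < \<eta>" by blast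
  qed
qed

section \<open>The limit represents the distribution\<close>

text \<open>Infinite values become \<open>0\<close> here; inside \<open>X\<close> they occur on a null set only.\<close>

definition w :: "real^'n \<Rightarrow> real" where "w y = real_of_ereal (W y)"

lemma openin_W_less: "openin (top_of_set X) {x \<in> X. W x < a}"
proof -
  have "\<exists>d>0. ball x d \<subseteq> {x \<in> X. W x < a}" if x: "x \<in> X" "W x < a" for x
  proof -
    obtain d b where d: "d > 0" "ball x d \<subseteq> X" "ereal b \<le> a" "\<And>y. y \<in> ball x d \<Longrightarrow> W y < b"
      using W_less_nearby[OF x(2,1)] by metis
    have "ball x d \<subseteq> {x \<in> X. W x < a}"
    proof
      fix y assume y: "y \<in> ball x d"
      have "W y < a" using d(4)[OF y] d(3) by (rule less_le_trans)
      then show "y \<in> {x \<in> X. W x < a}" using d(2) y by auto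
    qed
    with d(1) show ?thesis by blast
  qed
  then have "open {x \<in> X. W x < a}" unfolding open_contains_ball by blast
  then show ?thesis by (auto intro: open_subset)
qed

lemma W_measurable: "W \<in> borel_measurable (lebesgue_on X)"
proof (rule borel_measurableI_less)
  fix a
  have "open {x \<in> X. W x < a}"
    using openin_W_less X by (metis openin_open_eq)
  then show "{x \<in> space (lebesgue_on X). W x < a} \<in> sets (lebesgue_on X)"
    using X by (subst sets_restrict_space_iff) auto
qed

lemma w_measurable: "w \<in> borel_measurable (lebesgue_on X)"
  unfolding w_def[abs_def] using W_measurable by (rule borel_measurable_real_of_ereal)

lemma W_not_PInf: "x \<in> X \<Longrightarrow> W x < \<infinity>"
proof -
  assume "x \<in> X"
  then obtain s where "admissible s x" by (rule admissible_exists)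
  then have "W x \<le> ereal (V s x / mass)" unfolding W_def by (intro INF_lower) simp
  then show ?thesis by (rule le_less_trans) simp
qed

lemma V_limit_finite:
  assumes "y \<in> X" "W y \<noteq> - \<infinity>"
  shows "(\<lambda>k. V (real k) y) \<longlonglongrightarrow> mass * w y"
proof -
  have "W y = ereal (w y)"
    using W_not_PInf[OF assms(1)] assms(2) unfolding w_def by (cases "W y") auto
  then have "(\<lambda>k. V (real k) y / mass) \<longlonglongrightarrow> w y"
    using W_limit[OF assms(1)] by simp
  from tendsto_mult_left[OF this, of mass] show ?thesis
    using mass_pos by simp
qed

text \<open>Beppo Levi's argument. From an index \<open>k0\<close> on, \<open>\<phi> * V k\<close> is a decreasing sequence with integrals converging to
  \<open>mass * u \<phi>\<close>. The increments \<open>h j\<close> against the first member are non-negative and increasing with bounded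
  integrals, so their limit is finite almost everywhere: \<open>W\<close> cannot be \<open>-\<infinity>\<close> on a set of positive measure where
  \<open>\<phi>\<close> is positive. Monotone convergence then identifies the integral.\<close>

lemma pairing_w_nonneg:
  assumes \<phi>: "\<phi> \<in> test_functions X" and nonneg: "\<And>x. \<phi> x \<ge> 0"
  shows "AE y in lebesgue. \<phi> y > 0 \<longrightarrow> W y \<noteq> - \<infinity>"
    and "integrable lebesgue (\<lambda>y. w y * \<phi> y)" "(LINT y|lebesgue. w y * \<phi> y) = u \<phi>"
proof -
  obtain k0 where k0: "k0 > 0"
    "\<And>k. k \<ge> k0 \<Longrightarrow> (\<Union>x\<in>closure {x. \<phi> x \<noteq> 0}. cball x (R / real k)) \<subseteq> X"
    "\<And>k y. k \<ge> k0 \<Longrightarrow> \<phi> y \<noteq> 0 \<Longrightarrow> admissible (real k) y"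
    using eventually_thick[OF \<phi>] by metis
  obtain l r where lr: "cball 0 R \<subseteq> cbox l (r :: real^'n)"
    using bounded_subset_cbox_symmetric[OF bounded_cball] by metis
  define g where "g k y = \<phi> y * V (real k) y" for k y
  define h where "h j y = g k0 y - g (k0 + j) y" for j y
  have g_lborel: "integrable lborel (g k)" if "k \<ge> k0" for k
    unfolding g_def using k0(1) that by (intro pairing_V(1)[OF \<phi> _ k0(2)[OF that] lr]) simp
  then have g_int: "integrable lebesgue (g k)" if "k \<ge> k0" for k
    using that integrable_completion borel_measurable_integrable by metis
  have g_lim: "(\<lambda>k. LINT y|lebesgue. g k y) \<longlonglongrightarrow> mass * u \<phi>"
  proof (rule Lim_transform_eventually[OF pairing_limit[OF \<phi>]])
    show "\<forall>\<^sub>F k in sequentially. (LINT y|lborel. \<phi> y * V (real k) y) = (LINT y|lebesgue. g k y)"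
      unfolding eventually_sequentially
    proof (intro exI[of _ k0] allI impI)
      fix k assume "k0 \<le> k"
      then have "(LINT y|lebesgue. g k y) = (LINT y|lborel. g k y)"
        by (intro integral_completion borel_measurable_integrable g_lborel)
      then show "(LINT y|lborel. \<phi> y * V (real k) y) = (LINT y|lebesgue. g k y)"
        by (simp add: g_def)
    qed
  qed
  have g_mono: "g k' y \<le> g k y" if "k0 \<le> k" "k \<le> k'" for k k' y
  proof (cases "\<phi> y = 0")
    case False
    then have "V (real k') y \<le> V (real k) y"
      using k0(3)[OF that(1)] that(2) by (intro V_antimono) auto
    then show ?thesis unfolding g_def using nonneg by (intro mult_left_mono) auto
  qed (simp add: g_def)
  have h_int: "integrable lebesgue (h j)" for j
    unfolding h_def by (intro Bochner_Integration.integrable_diff g_int) auto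
  have h_nonneg: "h j y \<ge> 0" for j y
    unfolding h_def using g_mono by simp
  have h_mono: "h i y \<le> h j y" if "i \<le> j" for i j y
    unfolding h_def using g_mono[of "k0 + i" "k0 + j" y] that by simp
  have h_lim: "(\<lambda>j. LINT y|lebesgue. h j y) \<longlonglongrightarrow> (LINT y|lebesgue. g k0 y) - mass * u \<phi>"
  proof -
    have "(\<lambda>j. LINT y|lebesgue. g (j + k0) y) \<longlonglongrightarrow> mass * u \<phi>"
      using g_lim by (rule LIMSEQ_ignore_initial_segment)
    from tendsto_diff[OF tendsto_const this] show ?thesis
      unfolding h_def by (simp add: g_int add.commute)
  qed
  show finite: "AE y in lebesgue. \<phi> y > 0 \<longrightarrow> W y \<noteq> - \<infinity>"
  proof -
    obtain C where C: "\<And>j. (LINT y|lebesgue. h j y) \<le> C"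
      using convergent_imp_Bseq[OF convergentI[OF h_lim]] unfolding Bseq_def
      by (metis abs_le_D1 real_norm_def)
    have "(\<integral>\<^sup>+ y. (SUP j. ennreal (h j y)) \<partial>lebesgue) = (SUP j. \<integral>\<^sup>+ y. ennreal (h j y) \<partial>lebesgue)"
      using h_mono borel_measurable_integrable[OF h_int]
      by (intro nn_integral_monotone_convergence_SUP) (auto simp: incseq_def le_fun_def intro!: ennreal_leI)
    also have "\<dots> \<le> ennreal C"
      by (rule SUP_least) (simp add: nn_integral_eq_integral[OF h_int] h_nonneg C ennreal_leI)
    finally have "(\<integral>\<^sup>+ y. (SUP j. ennreal (h j y)) \<partial>lebesgue) \<noteq> \<infinity>"
      by (metis ennreal_less_top infinity_ennreal_def leD)
    moreover have "(\<lambda>y. SUP j. ennreal (h j y)) \<in> borel_measurable lebesgue"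
      using borel_measurable_integrable[OF h_int] by (intro borel_measurable_SUP measurable_compose[OF _ measurable_ennreal]) auto
    ultimately have "AE y in lebesgue. (SUP j. ennreal (h j y)) \<noteq> \<infinity>"
      by (intro nn_integral_PInf_AE)
    then show ?thesis
    proof eventually_elim
      fix y assume fin: "(SUP j. ennreal (h j y)) \<noteq> \<infinity>"
      show "\<phi> y > 0 \<longrightarrow> W y \<noteq> - \<infinity>"
      proof (intro impI notI)
        assume \<phi>y: "\<phi> y > 0" and "W y = - \<infinity>"
        obtain c where c: "c \<ge> 0" "(SUP j. ennreal (h j y)) = ennreal c"
          using fin by (cases "SUP j. ennreal (h j y)") auto
        have hc: "h j y \<le> c" for j
          using SUP_upper[of j UNIV "\<lambda>j. ennreal (h j y)"] c by (simp add: h_nonneg)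
        have "y \<in> X" using test_functions_eq_0[OF \<phi>] \<phi>y by force
        from W_limit[OF this] have "(\<lambda>k. ereal (V (real k) y / mass)) \<longlonglongrightarrow> - \<infinity>"
          using \<open>W y = - \<infinity>\<close> by simp
        then have "\<forall>\<^sub>F k in sequentially. ereal (V (real k) y / mass) < ereal ((g k0 y - c - 1) / (\<phi> y * mass))"
          by (rule order_tendstoD(2)) simp
        then obtain N where N: "\<And>k. k \<ge> N \<Longrightarrow> V (real k) y / mass < (g k0 y - c - 1) / (\<phi> y * mass)"
          unfolding eventually_sequentially by auto
        have "g (k0 + N) y < g k0 y - c - 1"
          using N[of "k0 + N"] mass_pos \<phi>y by (simp add: g_def field_simps)
        then show False using hc[of N] by (simp add: h_def)
      qed
    qed
  qed
  have w_meas: "(\<lambda>y. w y * \<phi> y) \<in> borel_measurable lebesgue"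
  proof -
    have "\<phi> \<in> borel_measurable lebesgue"
      using borel_measurable_continuous_onI[OF smooth_continuous[OF test_functionsD(1)[OF \<phi>]]]
      by (simp add: measurable_completion)
    then have "(\<lambda>y. w y * \<phi> y) \<in> borel_measurable (lebesgue_on X)"
      by (intro borel_measurable_times w_measurable) (rule measurable_restrict_space1)
    then have "(\<lambda>y. indicator X y *\<^sub>R (w y * \<phi> y)) \<in> borel_measurable lebesgue"
      using X by (subst (asm) borel_measurable_restrict_space_iff) auto
    moreover have "(\<lambda>y. indicator X y *\<^sub>R (w y * \<phi> y)) = (\<lambda>y. w y * \<phi> y)"
      using test_functions_eq_0[OF \<phi>] by (auto simp: fun_eq_iff indicator_def)
    ultimately show ?thesis by simp
  qed
  have lim: "AE y in lebesgue. (\<lambda>j. h j y) \<longlonglongrightarrow> g k0 y - mass * (w y * \<phi> y)"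
    using finite
  proof eventually_elim
    fix y assume fin: "\<phi> y > 0 \<longrightarrow> W y \<noteq> - \<infinity>"
    have "(\<lambda>k. g k y) \<longlonglongrightarrow> mass * (w y * \<phi> y)"
    proof (cases "\<phi> y = 0")
      case False
      then have "y \<in> X" "\<phi> y > 0" using test_functions_eq_0[OF \<phi>] nonneg[of y] by force+
      then have "(\<lambda>k. V (real k) y) \<longlonglongrightarrow> mass * w y" using fin by (intro V_limit_finite) auto
      from tendsto_mult_left[OF this, of "\<phi> y"] show ?thesis by (simp add: g_def mult_ac)
    qed (simp add: g_def)
    then have "(\<lambda>j. g (j + k0) y) \<longlonglongrightarrow> mass * (w y * \<phi> y)"
      by (rule LIMSEQ_ignore_initial_segment)
    from tendsto_diff[OF tendsto_const this] show "(\<lambda>j. h j y) \<longlonglongrightarrow> g k0 y - mass * (w y * \<phi> y)"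
      unfolding h_def by (simp add: add.commute)
  qed
  have meas: "(\<lambda>y. g k0 y - mass * (w y * \<phi> y)) \<in> borel_measurable lebesgue"
    by (rule borel_measurable_diff[OF borel_measurable_integrable[OF g_int[OF order_refl]]
          borel_measurable_times[OF borel_measurable_const w_meas]])
  have mono: "AE y in lebesgue. mono (\<lambda>j. h j y)"
    using h_mono by (intro AE_I2 monoI)
  have nn: "AE y in lebesgue. 0 \<le> h j y" for j
    using h_nonneg by (intro AE_I2)
  note conv = integral_monotone_convergence_nonneg[OF h_int mono nn lim h_lim meas]
  have eq: "w y * \<phi> y = (1 / mass) * (g k0 y - (g k0 y - mass * (w y * \<phi> y)))" for y
    using mass_pos by simp
  have int: "integrable lebesgue (\<lambda>y. (1 / mass) * (g k0 y - (g k0 y - mass * (w y * \<phi> y))))"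
    by (intro integrable_mult_right Bochner_Integration.integrable_diff g_int order_refl conv(1))
  then show "integrable lebesgue (\<lambda>y. w y * \<phi> y)" by (simp only: eq[symmetric])
  have "(LINT y|lebesgue. w y * \<phi> y) = (1 / mass) * ((LINT y|lebesgue. g k0 y) - ((LINT y|lebesgue. g k0 y) - mass * u \<phi>))"
    by (subst eq) (simp only: integral_mult_right_zero Bochner_Integration.integral_diff[OF g_int[OF order_refl] conv(1)] conv(2))
  then show "(LINT y|lebesgue. w y * \<phi> y) = u \<phi>" using mass_pos by simp
qed

text \<open>On a compact set \<open>\<bar>w\<bar>\<close> is at most \<open>\<bar>w * \<eta>\<bar>\<close> for a non-negative test function \<open>\<eta>\<close> that is at least \<open>1\<close> there.\<close>

lemma w_L1_loc: "w \<in> L1_loc X"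
  unfolding L1_loc_def
proof (intro CollectI allI impI)
  fix K assume K: "compact K \<and> K \<subseteq> X"
  obtain \<eta> where \<eta>: "\<eta> \<in> test_functions X" "\<And>x. \<eta> x \<ge> 0" "\<And>x. x \<in> K \<Longrightarrow> \<eta> x \<ge> 1"
    using test_function_ge_1[OF conjunct1[OF K] X conjunct2[OF K]] by metis
  have "(\<lambda>x. indicator X x *\<^sub>R w x) \<in> borel_measurable lebesgue"
    using w_measurable X by (subst (asm) borel_measurable_restrict_space_iff) auto
  moreover have "indicat_real K \<in> borel_measurable lebesgue"
    using fmeasurableD[OF lmeasurable_compact[OF conjunct1[OF K]]] by (rule borel_measurable_indicator)
  ultimately have "(\<lambda>x. indicator K x * (indicator X x *\<^sub>R w x)) \<in> borel_measurable lebesgue"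
    by (intro borel_measurable_times)
  moreover have "(\<lambda>x. indicator K x * (indicator X x *\<^sub>R w x)) = (\<lambda>x. indicator K x *\<^sub>R w x)"
    using K by (auto simp: fun_eq_iff indicator_def)
  ultimately have meas: "(\<lambda>x. indicator K x *\<^sub>R w x) \<in> borel_measurable lebesgue" by simp
  show "w absolutely_integrable_on K"
    unfolding set_integrable_def
  proof (rule Bochner_Integration.integrable_bound[OF pairing_w_nonneg(2)[OF \<eta>(1,2)] meas], rule AE_I2)
    fix x
    show "norm (indicator K x *\<^sub>R w x) \<le> norm (w x * \<eta> x)"
    proof (cases "x \<in> K")
      case True
      have "\<bar>w x\<bar> * 1 \<le> \<bar>w x\<bar> * \<eta> x" using \<eta>(3)[OF True] by (intro mult_left_mono) auto
      then show ?thesis using True \<eta>(2)[of x] by (simp add: abs_mult)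
    qed simp
  qed
qed

text \<open>A test function is the difference of two non-negative ones: add and subtract a large multiple of a cutoff.\<close>

lemma pairing_w:
  assumes \<phi>: "\<phi> \<in> test_functions X"
  shows "(LINT y|lebesgue. w y * \<phi> y) = u \<phi>"
proof -
  define S where "S = closure {x. \<phi> x \<noteq> 0}"
  note \<phi>D = test_functionsD[OF \<phi>, folded S_def]
  obtain \<eta> where \<eta>: "\<eta> \<in> test_functions X" "\<And>x. \<eta> x \<ge> 0" "\<And>x. x \<in> S \<Longrightarrow> \<eta> x \<ge> 1"
    using test_function_ge_1[OF \<phi>D(2) X \<phi>D(3)] by metis
  have "bounded (\<phi> ` S)"
    by (intro compact_imp_bounded compact_continuous_image smooth_continuous \<phi>D)
  then obtain M where M: "\<And>x. x \<in> S \<Longrightarrow> \<bar>\<phi> x\<bar> \<le> M" unfolding bounded_iff by auto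
  define \<psi> where "\<psi> x = 1 * \<phi> x + \<bar>M\<bar> * \<eta> x" for x
  have \<psi>_test: "\<psi> \<in> test_functions X"
    unfolding \<psi>_def[abs_def] by (intro test_functions_lincomb \<phi> \<eta>(1))
  have \<psi>_nonneg: "\<psi> x \<ge> 0" for x
  proof (cases "x \<in> S")
    case True
    have "\<bar>M\<bar> * 1 \<le> \<bar>M\<bar> * \<eta> x" using \<eta>(3)[OF True] by (intro mult_left_mono) auto
    then show ?thesis using M[OF True] by (simp add: \<psi>_def)
  next
    case False
    then have "\<phi> x = 0" using eq_0_outside_closure unfolding S_def by blast
    then show ?thesis using \<eta>(2)[of x] by (simp add: \<psi>_def)
  qed
  note I = pairing_w_nonneg(2,3)[OF \<psi>_test \<psi>_nonneg] pairing_w_nonneg(2,3)[OF \<eta>(1,2)]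
  have eq: "w y * \<phi> y = w y * \<psi> y - \<bar>M\<bar> * (w y * \<eta> y)" for y
    by (simp add: \<psi>_def algebra_simps)
  have "(LINT y|lebesgue. w y * \<phi> y) = u \<psi> - \<bar>M\<bar> * u \<eta>"
    unfolding eq by (subst Bochner_Integration.integral_diff[OF I(1) integrable_mult_right[OF I(3)]]) (simp add: I(2,4))
  also have "u \<psi> = u \<phi> + \<bar>M\<bar> * u \<eta>"
    unfolding \<psi>_def[abs_def] by (subst distribution_lincomb[OF u \<phi> \<eta>(1)]) simp
  finally show ?thesis by simp
qed

lemma w_represents: "represents X w u"
  unfolding represents_def using w_L1_loc pairing_w lebesgue_on_test[OF X] by simp

lemma W_finite_AE: "AE y in lebesgue. y \<in> X \<longrightarrow> W y \<noteq> - \<infinity>"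
proof -
  obtain C :: "nat \<Rightarrow> (real^'n) set" where C: "\<And>n. compact (C n)" "\<And>n. C n \<subseteq> X"
    "\<And>x. x \<in> X \<Longrightarrow> \<exists>N. \<forall>n\<ge>N. x \<in> C n"
    using compact_exhaustion[OF X] by metis
  have "AE y in lebesgue. y \<in> C n \<longrightarrow> W y \<noteq> - \<infinity>" for n
  proof -
    obtain \<eta> where \<eta>: "\<eta> \<in> test_functions X" "\<And>x. \<eta> x \<ge> 0" "\<And>x. x \<in> C n \<Longrightarrow> \<eta> x \<ge> 1"
      using test_function_ge_1[OF C(1) X C(2)] by metis
    show ?thesis
      using pairing_w_nonneg(1)[OF \<eta>(1,2)]
    proof eventually_elim
      fix y assume "\<eta> y > 0 \<longrightarrow> W y \<noteq> - \<infinity>"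
      then show "y \<in> C n \<longrightarrow> W y \<noteq> - \<infinity>" using \<eta>(3)[of y] by auto
    qed
  qed
  then have "AE y in lebesgue. \<forall>n. y \<in> C n \<longrightarrow> W y \<noteq> - \<infinity>"
    by (intro AE_all_countable[THEN iffD2] allI)
  then show ?thesis
    by eventually_elim (use C(3) in blast)
qed

lemma represents_AE_eq_W:
  assumes "represents X f u"
  shows "AE y in lebesgue. y \<in> X \<longrightarrow> ereal (f y) = W y"
proof -
  have f: "f \<in> L1_loc X" "\<And>\<phi>. \<phi> \<in> test_functions X \<Longrightarrow> u \<phi> = (LINT x|lebesgue. f x * \<phi> x)"
    using assms lebesgue_on_test[OF X] unfolding represents_def by auto
  have "AE y in lebesgue. y \<in> X \<longrightarrow> f y - w y = 0"
  proof (rule fundamental_lemma[OF _ X])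
    show "(\<lambda>y. f y - w y) \<in> L1_loc X"
      using f(1) w_L1_loc unfolding L1_loc_def by (auto intro: set_integral_diff)
    fix \<phi> assume \<phi>: "\<phi> \<in> test_functions X"
    show "(LINT y|lebesgue. (f y - w y) * \<phi> y) = 0"
      using L1_loc_mult_test[OF f(1) \<phi>] L1_loc_mult_test[OF w_L1_loc \<phi>] f(2)[OF \<phi>] pairing_w[OF \<phi>]
      by (simp add: left_diff_distrib)
  qed
  then show ?thesis
    using W_finite_AE
  proof eventually_elim
    fix y assume "y \<in> X \<longrightarrow> f y - w y = 0" "y \<in> X \<longrightarrow> W y \<noteq> - \<infinity>"
    then show "y \<in> X \<longrightarrow> ereal (f y) = W y"
      using W_not_PInf[of y] by (cases "W y") (auto simp: w_def)
  qed
qed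

text \<open>Since \<open>H\<close> is even, the kernel is symmetric in centre and variable, and the integral in the centre from
  \<open>kernel_has_integral\<close> can be used.\<close>

lemma kernel_integral:
  assumes "s > 0"
  shows "integrable lebesgue (kernel s y)" "(LINT x|lebesgue. kernel s y x) = mass"
proof -
  have one: "(\<lambda>x. 1) \<in> L1_loc (UNIV :: (real^'n) set)"
  proof -
    have "integrable lebesgue (\<lambda>x. indicat_real K x)" if "compact K" for K :: "(real^'n) set"
      using lmeasurable_compact[OF that] by (intro integrable_real_indicator) (auto simp: fmeasurable_def)
    then show ?thesis by (simp add: L1_loc_def set_integrable_def)
  qed
  show int: "integrable lebesgue (kernel s y)"
    using L1_loc_mult_test[OF one kernel_test_function[OF assms, of y]] by simp
  obtain l r where lr: "cball 0 R \<subseteq> cbox l (r :: real^'n)"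
    using bounded_subset_cbox_symmetric[OF bounded_cball] by metis
  have "H (- z) = H z" for z
    by (simp add: H_def quad_def linear_neg[OF matrix_vector_mul_linear])
  then have "kernel s x y = kernel s y x" for x
    unfolding affine_copy_def by (metis minus_diff_eq scaleR_minus_right)
  then have "(kernel s y has_integral mass) UNIV"
    using kernel_has_integral[OF assms smooth_const[of 1] lr, of y] mass_eq[OF lr] by simp
  then show "(LINT x|lebesgue. kernel s y x) = mass"
    using has_integral_unique has_integral_integral_lebesgue[OF int] by blast
qed

section \<open>The essential limit superior\<close>

text \<open>The value \<open>W x\<close> is bounded above by weighted means of \<open>f\<close> over small ellipsoids around \<open>x\<close>, hence by
  the essential suprema; semicontinuity of \<open>W\<close> gives the converse estimate.\<close>

lemma ess_limsup_eq_W: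
  assumes f: "represents X f u" and x: "x \<in> X"
  shows "ess_limsup X (\<lambda>y. ereal (f y)) x = W x"
proof (rule antisym)
  have fL: "f \<in> L1_loc X" using f by (simp add: represents_def)
  have meas: "(\<lambda>y. ereal (f y)) \<in> borel_measurable (lebesgue_on (X \<inter> ball x r))" for r
    using measurable_restrict_mono[OF L1_loc_measurable[OF fL X], of "X \<inter> ball x r"] by simp
  have sets: "X \<inter> ball x r \<in> sets lebesgue" for r
    using X by (intro sets.Int) auto
  show "ess_limsup X (\<lambda>y. ereal (f y)) x \<le> W x"
  proof (rule dense_ge)
    fix a assume "W x < a"
    obtain d b where d: "d > 0" "ball x d \<subseteq> X" "ereal b \<le> a" "\<And>y. y \<in> ball x d \<Longrightarrow> W y < b"
      using W_less_nearby[OF \<open>W x < a\<close> x] by metis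
    have "AE y in lebesgue_on (X \<inter> ball x d). ereal (f y) \<le> b"
    proof (subst AE_restrict_space_iff)
      show "X \<inter> ball x d \<inter> space lebesgue \<in> sets lebesgue" using sets[of d] by simp
      show "AE y in lebesgue. y \<in> X \<inter> ball x d \<longrightarrow> ereal (f y) \<le> b"
        using represents_AE_eq_W[OF f]
      proof eventually_elim
        fix y assume "y \<in> X \<longrightarrow> ereal (f y) = W y"
        then show "y \<in> X \<inter> ball x d \<longrightarrow> ereal (f y) \<le> b"
          using d(4)[of y] by (metis IntE less_imp_le)
      qed
    qed
    then have "esssup (lebesgue_on (X \<inter> ball x d)) (\<lambda>y. ereal (f y)) \<le> b"
      by (rule esssup_I[OF meas])
    also note d(3)
    finally show "ess_limsup X (\<lambda>y. ereal (f y)) x \<le> a"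
      unfolding ess_limsup_def using d(1) by (intro INF_lower2[of d]) auto
  qed
  show "W x \<le> ess_limsup X (\<lambda>y. ereal (f y)) x"
    unfolding ess_limsup_def
  proof (rule INF_greatest)
    fix r :: real assume "r \<in> {0<..}"
    define E where "E = esssup (lebesgue_on (X \<inter> ball x r)) (\<lambda>y. ereal (f y))"
    show "W x \<le> E"
    proof (rule ccontr)
      assume "\<not> W x \<le> E"
      then have "E < W x" by simp
      then obtain M where M: "E < ereal M" "ereal M < W x" using ereal_dense2 by blast
      have "AE y in lebesgue_on (X \<inter> ball x r). ereal (f y) \<le> E"
        unfolding E_def by (rule esssup_AE)
      then have f_le: "AE y in lebesgue. y \<in> X \<inter> ball x r \<longrightarrow> ereal (f y) \<le> E"
        using sets[of r] by (subst (asm) AE_restrict_space_iff) auto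
      obtain s0 where s0: "admissible s0 x" using admissible_exists[OF x] .
      define s where "s = max s0 (2 * R / r)"
      have s: "admissible s x" using s0 by (rule admissible_mono) (simp add: s_def)
      have "s > 0" using s by (simp add: admissible_def)
      have "2 * R / r \<le> s" by (simp add: s_def)
      then have "R / s < r" using \<open>s > 0\<close> \<open>r \<in> {0<..}\<close> R_pos by (simp add: field_simps)
      have fK: "integrable lebesgue (\<lambda>y. f y * kernel s x y)"
        by (rule L1_loc_mult_test[OF fL kernel_admissible[OF s]])
      have MK: "integrable lebesgue (\<lambda>y. M * kernel s x y)"
        using kernel_integral(1)[OF \<open>s > 0\<close>] by simp
      have "V s x = (LINT y|lebesgue. f y * kernel s x y)"
        using f kernel_admissible[OF s] lebesgue_on_test[OF X kernel_admissible[OF s]]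
        unfolding V_def represents_def by simp
      also have "\<dots> \<le> (LINT y|lebesgue. M * kernel s x y)"
      proof (rule integral_mono_AE[OF fK MK])
        show "AE y in lebesgue. f y * kernel s x y \<le> M * kernel s x y"
          using f_le
        proof eventually_elim
          fix y assume y: "y \<in> X \<inter> ball x r \<longrightarrow> ereal (f y) \<le> E"
          show "f y * kernel s x y \<le> M * kernel s x y"
          proof (cases "y \<in> cball x (R / s)")
            case True
            then have "y \<in> X \<inter> ball x r"
              using s \<open>R / s < r\<close> unfolding admissible_def by auto
            then have "ereal (f y) < ereal M" using y M(1) le_less_trans by blast
            then show ?thesis
              using kernel_nonneg[OF \<open>s > 0\<close>, of x y] by (intro mult_right_mono) auto
          qed (simp add: affine_copy_GH_eq_0(2)[OF \<open>s > 0\<close>])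
        qed
      qed
      also have "\<dots> = M * mass" by (simp add: kernel_integral(2)[OF \<open>s > 0\<close>])
      finally have "V s x / mass \<le> M" using mass_pos by (simp add: field_simps)
      moreover have "W x \<le> ereal (V s x / mass)"
        unfolding W_def using s by (intro INF_lower) simp
      ultimately have "W x \<le> ereal M" by (meson ereal_less_eq(3) order_trans)
      then show False using M(2) by simp
    qed
  qed
qed

end

section \<open>From elliptic cones to elliptic operators\<close>

text \<open>The polar cone is convex and contains \<open>0\<close>; hence its span is its affine hull, and its relative interior
  is not empty.\<close>

lemma elliptic_cone_positive_definite:
  fixes P :: "(real^'n^'n) set"
  assumes "elliptic_cone P"
  obtains A where "A \<in> polar_cone P" "positive_definite A"
proof -
  let ?C = "polar_cone P"
  have zero: "0 \<in> ?C"
    by (simp add: polar_cone_def Sym2_def transpose_def vec_eq_iff trace_def matrix_matrix_mult_def)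
  have "convex ?C"
  proof (rule convexI)
    fix S T :: "real^'n^'n" and a b :: real
    assume ST: "S \<in> ?C" "T \<in> ?C" and ab: "0 \<le> a" "0 \<le> b"
    have "trace ((a *\<^sub>R S + b *\<^sub>R T) ** Q) = a * trace (S ** Q) + b * trace (T ** Q)" for Q
      by (simp add: trace_def matrix_matrix_mult_def sum_distrib_left sum.distrib algebra_simps)
    then show "a *\<^sub>R S + b *\<^sub>R T \<in> ?C"
      using ST ab unfolding polar_cone_def Sym2_def by (auto simp: transpose_def vec_eq_iff)
  qed
  then have "rel_interior ?C \<noteq> {}"
    using zero rel_interior_eq_empty by blast
  moreover have "rel_interior ?C \<subseteq> Int_polar P"
    using affine_hull_span_0[of ?C] hull_inc[OF zero, of affine]
    unfolding Int_polar_def rel_interior_def interior_of_def by auto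
  ultimately obtain A where A: "A \<in> Int_polar P" by blast
  show thesis
  proof (rule that[of A])
    show "A \<in> ?C" using A interior_of_subset[of "top_of_set (span ?C)" ?C] unfolding Int_polar_def by (rule subsetD[rotated])
    show "positive_definite A" using assms A by (simp add: elliptic_cone_def)
  qed
qed

text \<open>The form of \<open>B\<close> at \<open>x = A *v w\<close> is the form of \<open>A\<close> at \<open>w\<close>, so it is positive; its minimum on the unit sphere
  bounds the ellipsoid.\<close>

lemma positive_definite_ellipsoid:
  fixes A :: "real^'n^'n"
  assumes "positive_definite A"
  obtains B R where "ellipsoid A B R"
proof -
  have A_sym: "transpose A = A" and A_pos: "\<And>v. v \<noteq> 0 \<Longrightarrow> v \<bullet> (A *v v) > 0"
    using assms by (auto simp: positive_definite_def Sym2_def)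
  have "A *v v = 0 \<longrightarrow> v = 0" for v
    using A_pos[of v] by (cases "v = 0") auto
  then obtain B where BA: "B ** A = mat 1"
    using matrix_left_invertible_ker[of A] by blast
  then have AB: "A ** B = mat 1" using matrix_left_right_inverse by blast
  have B_sym: "transpose B = B"
  proof -
    have "transpose B ** A = mat 1"
      using arg_cong[OF AB, of transpose] A_sym by (simp add: matrix_transpose_mul)
    then show ?thesis
      by (metis AB matrix_mul_assoc matrix_mul_lid matrix_mul_rid)
  qed
  define Q where "Q x = x \<bullet> (B *v x)" for x
  have Q_pos: "Q x > 0" if "x \<noteq> 0" for x
  proof -
    have x: "x = A *v (B *v x)" by (simp add: AB matrix_vector_mul_assoc)
    then have "B *v x \<noteq> 0" using that by (metis matrix_vector_mult_0_right)
    from A_pos[OF this] show ?thesis using x by (simp add: Q_def inner_commute)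
  qed
  have "continuous_on (sphere 0 1) Q"
    unfolding Q_def[abs_def]
    by (intro continuous_intros linear_continuous_on matrix_vector_mul_bounded_linear)
  moreover have "sphere (0::real^'n) 1 \<noteq> {}" by simp
  ultimately obtain x0 where x0: "x0 \<in> sphere 0 1" "\<And>x. x \<in> sphere 0 1 \<Longrightarrow> Q x0 \<le> Q x"
    using continuous_attains_inf[OF compact_sphere] by blast
  have m: "Q x0 > 0" using x0(1) by (intro Q_pos) auto
  have lower: "Q x0 * (norm x)\<^sup>2 \<le> Q x" for x
  proof (cases "x = 0")
    case False
    have "Q x0 \<le> Q (x /\<^sub>R norm x)" using False by (intro x0(2)) simp
    also have "\<dots> = Q x / (norm x)\<^sup>2"
      by (simp add: Q_def matrix_vector_mult_scaleR power2_eq_square field_simps)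
    finally show ?thesis using False by (simp add: field_simps)
  qed (simp add: Q_def)
  define R where "R = sqrt (1 / Q x0)"
  have "R > 0" using m by (simp add: R_def)
  have R: "norm x \<le> R" if "x \<bullet> (B *v x) < 1" for x
  proof -
    have "Q x0 * (norm x)\<^sup>2 \<le> 1" using lower[of x] that by (simp add: Q_def)
    then have "(norm x)\<^sup>2 \<le> 1 / Q x0" using m by (simp add: field_simps)
    then show ?thesis unfolding R_def by (rule real_le_rsqrt)
  qed
  have "ellipsoid A B R"
    by unfold_locales (use A_sym B_sym AB \<open>R > 0\<close> R in auto)
  then show thesis by (rule that)
qed

lemma Hess_eq_elliptic_op:
  assumes u: "distribution_on X u" and \<phi>: "\<phi> \<in> test_functions X"
  shows "Hess u (\<lambda>x. \<phi> x *\<^sub>R A) = u (elliptic_op A \<phi>)"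
proof -
  note t = test_functions_pderiv[OF test_functions_pderiv[OF \<phi>]]
  have "dist_pderiv i (dist_pderiv j u) (\<lambda>x. (\<phi> x *\<^sub>R A) $ i $ j) = A $ i $ j * u (pderiv_dir j (pderiv_dir i \<phi>))" for i j
  proof -
    have "foldr pderiv_dir [j, i] (\<lambda>x. A $ i $ j * \<phi> x + 0 * \<phi> x)
        = (\<lambda>x. A $ i $ j * foldr pderiv_dir [j, i] \<phi> x + 0 * foldr pderiv_dir [j, i] \<phi> x)"
      by (intro foldr_pderiv_lincomb test_functionsD[OF \<phi>])
    then have "pderiv_dir j (pderiv_dir i (\<lambda>x. \<phi> x * A $ i $ j)) = (\<lambda>x. A $ i $ j * pderiv_dir j (pderiv_dir i \<phi>) x)"
      by (simp add: mult.commute)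
    then show ?thesis
      by (simp add: dist_pderiv_def distribution_cmult[OF u t])
  qed
  then have "Hess u (\<lambda>x. \<phi> x *\<^sub>R A) = (\<Sum>i\<in>UNIV. 1 * (\<Sum>j\<in>UNIV. A $ i $ j * u (pderiv_dir j (pderiv_dir i \<phi>))))"
    by (simp add: Hess_def)
  also have "\<dots> = (\<Sum>i\<in>UNIV. 1 * u (\<lambda>x. \<Sum>j\<in>UNIV. A $ i $ j * pderiv_dir j (pderiv_dir i \<phi>) x))"
    by (simp add: distribution_sum[OF u t])
  also have "\<dots> = u (\<lambda>x. \<Sum>i\<in>UNIV. 1 * (\<Sum>j\<in>UNIV. A $ i $ j * pderiv_dir j (pderiv_dir i \<phi>) x))"
    by (rule distribution_sum[OF u test_functions_sum[OF t], symmetric])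
  finally show ?thesis by (simp add: elliptic_op_def[abs_def])
qed

theorem proposition5p2:
  fixes P :: "(real^'n^'n) set"
    and X :: "(real^'n) set"
    and u :: "(real^'n \<Rightarrow> real) \<Rightarrow> real"
  assumes "elliptic_cone P"
    and "open X" and "connected X"
    and "plurisubharmonic_dist P X u"
  shows "(\<exists>f. represents X f u) \<and>
    (\<forall>f. represents X f u \<longrightarrow>
       ess_limsup X (\<lambda>y. ereal (f y)) \<in> USC X \<and>
       (AE x in lebesgue_on X. ess_limsup X (\<lambda>y. ereal (f y)) x = ereal (f x)))"
proof -
  obtain A where A: "A \<in> polar_cone P" "positive_definite A"
    using elliptic_cone_positive_definite[OF assms(1)] .
  obtain B R where "ellipsoid A B R"
    using positive_definite_ellipsoid[OF A(2)] .
  then interpret ellipsoid A B R .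
  interpret subsolution A B R X u
  proof
    show u: "distribution_on X u" using assms(4) by (simp add: plurisubharmonic_dist_def)
    fix \<phi> assume "\<phi> \<in> test_functions X" "\<And>x. \<phi> x \<ge> 0"
    moreover from this have "0 \<le> Hess u (\<lambda>x. \<phi> x *\<^sub>R A)"
      using assms(4) A(1) unfolding plurisubharmonic_dist_def by blast
    ultimately show "0 \<le> u (elliptic_op A \<phi>)"
      by (simp only: Hess_eq_elliptic_op[OF u])
  qed (rule assms(2))
  show ?thesis
  proof (intro conjI allI impI)
    show "\<exists>f. represents X f u" using w_represents by blast
  next
    fix f assume f: "represents X f u"
    show "AE x in lebesgue_on X. ess_limsup X (\<lambda>y. ereal (f y)) x = ereal (f x)"
      using represents_AE_eq_W[OF f] X
      by (subst AE_restrict_space_iff) (auto elim!: eventually_mono simp: ess_limsup_eq_W[OF f])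
    show "ess_limsup X (\<lambda>y. ereal (f y)) \<in> USC X"
      unfolding USC_def
    proof (intro CollectI conjI ballI allI)
      show "ess_limsup X (\<lambda>y. ereal (f y)) x < \<infinity>" if "x \<in> X" for x
        using ess_limsup_eq_W[OF f that] W_not_PInf[OF that] by simp
      show "openin (top_of_set X) {x \<in> X. ess_limsup X (\<lambda>y. ereal (f y)) x < a}" for a
        using openin_W_less[of a] ess_limsup_eq_W[OF f] by (simp cong: conj_cong)
      fix C assume C: "C \<in> components X"
      then have "C = X" "X \<noteq> {}"
        using assms(3) components_eq_sing_iff[of X] by (cases "X = {}"; auto)+
      have "\<exists>x\<in>X. W x \<noteq> - \<infinity>"
      proof (rule ccontr)
        assume "\<not> (\<exists>x\<in>X. W x \<noteq> - \<infinity>)"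
        then have "AE y in lebesgue. y \<notin> X"
          using W_finite_AE by (auto elim: eventually_mono)
        then have "negligible X"
          using X AE_iff_null_sets[of X lebesgue] negligible_iff_null_sets by auto
        then show False using open_not_negligible[OF X \<open>X \<noteq> {}\<close>] by simp
      qed
      then show "\<exists>x\<in>C. ess_limsup X (\<lambda>y. ereal (f y)) x \<noteq> - \<infinity>"
        using \<open>C = X\<close> ess_limsup_eq_W[OF f] by auto
    qed
  qed
qed

end
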